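(* Let $m\geqslant 2$, let $B$ be a simple Lie algebra over a field $F$, let $\gamma\in F$, and suppose $F$ contains a primitive $m$th root of unity $\zeta$. Let $L^{(0)}:=B$, let $L^{(i)}$, $1\leqslant i\leqslant m-1$, be vector spaces $F$-linearly isomorphic to $B$, let $\varphi\colon L^{(i-1)}\to L^{(i)}$, $1\leqslant i\leqslant m-1$, be the corresponding $F$-linear bijections (all denoted by the same letter), and put $\varphi(L^{(m-1)}):=0$. Consider the $H_{m^2}(\zeta)$-module $L(B,\gamma):=\bigoplus_{i=0}^{m-1}L^{(i)}$ (direct sum of subspaces) where $v\varphi(a)=a$ for all $a\in L^{(i)}$, $0\leqslant i\leqslant m-2$, $vB=0$, and $ca^{(i)}=\zeta^i a^{(i)}$ for all $a^{(i)}\in L^{(i)}$. Define a commutator on $L(B,\gamma)$ by $$[\varphi^k(a),\varphi^\ell(b)]:=\begin{cases}\binom{k+\ell}{k}_\zeta\,\varphi^{k+\ell}[a,b] & \text{if } k+\ell<m,\\[4pt] \gamma\,\dfrac{(k+\ell-m)!_\zeta}{k!_\zeta\,\ell!_\zeta}\,\varphi^{k+\ell-m}[a,b] & \text{if } k+\ell\geqslant m\end{cases}$$ for all $a,b\in B$ and $0\leqslant k,\ell<m$ (extended bilinearly). Then $L(B,\gamma)$ is an $H_{m^2}(\zeta)$-simple ($H_{m^2}(\zeta)$-module) Lie algebra.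
   Context: The Taft algebra $H_{m^2}(\zeta)$ is the unital associative $F$-algebra generated by $c,v$ with relations $c^m=1$, $v^m=0$, $vc=\zeta cv$; it is a Hopf algebra with $\Delta(c)=c\otimes c$, $\Delta(v)=c\otimes v+v\otimes 1$, $\varepsilon(c)=1$, $\varepsilon(v)=0$, $S(c)=c^{-1}$, $S(v)=-c^{-1}v$. An $H_{m^2}(\zeta)$-module Lie algebra is a Lie algebra $L$ over $F$ that is a left $H_{m^2}(\zeta)$-module with $h[a,b]=[h_{(1)}a,h_{(2)}b]$ for all $h$ and all $a,b\in L$; in particular $c$ acts by a Lie automorphism and $v[a,b]=[ca,vb]+[va,b]$. $L$ is $H_{m^2}(\zeta)$-simple if $[L,L]\neq 0$ and $L$ has no $H_{m^2}(\zeta)$-invariant ideals other than $0$ and $L$. Quantum notation: $n_\zeta:=1+\zeta+\dots+\zeta^{n-1}$, $n!_\zeta:=n_\zeta(n-1)_\zeta\cdots 1_\zeta$ for $n\in\mathbb N$, $0!_\zeta:=1$, $\binom{n}{k}_\zeta:=\dfrac{n!_\zeta}{(n-k)!_\zeta\,k!_\zeta}$, $\binom n0_\zeta=\binom nn_\zeta:=1$. *)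

theory Defs
  imports "HOL-Algebra.QuotRing" "HOL-Algebra.Algebraic_Closure_Type" "HOL-Library.Poly_Mapping" "HOL-Library.Product_Plus"
begin

section \<open>Quantum integers\<close>

definition prim_root_unity :: "nat \<Rightarrow> 'f::field \<Rightarrow> bool" where
  "prim_root_unity m z \<longleftrightarrow> 0 < m \<and> z ^ m = 1 \<and> (\<forall>k. 0 < k \<and> k < m \<longrightarrow> z ^ k \<noteq> 1)"

definition qint :: "'f::field \<Rightarrow> nat \<Rightarrow> 'f" where
  "qint z n = (\<Sum>i<n. z ^ i)"

definition qfact :: "'f::field \<Rightarrow> nat \<Rightarrow> 'f" where
  "qfact z n = (\<Prod>i=1..n. qint z i)"

definition qbinom :: "'f::field \<Rightarrow> nat \<Rightarrow> nat \<Rightarrow> 'f" where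
  "qbinom z n k =
     (if k = 0 \<or> k = n then 1 else qfact z n / (qfact z (n - k) * qfact z k))"


section \<open>The Taft algebra\<close>

text \<open>
  Words in the two generators form a monoid under concatenation (written additively, as
  \<^type>\<open>poly_mapping\<close> expects). Hence \<open>'f free_alg\<close>, with the convolution product, is
  the free associative unital algebra on \<open>c\<close>, \<open>v\<close>, and \<open>'f free_alg2\<close>, the monoid algebra of
  pairs of words, is the tensor square of that algebra.
\<close>

datatype gen = GenC | GenV

datatype word = Word (letters: "gen list")

instantiation word :: monoid_add
begin

definition zero_word :: word where "0 = Word []"

definition plus_word :: "word \<Rightarrow> word \<Rightarrow> word" where
  "x + y = Word (letters x @ letters y)"

instance
  by standard (simp_all add: zero_word_def plus_word_def)

end

type_synonym 'f free_alg = "word \<Rightarrow>\<^sub>0 'f"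
type_synonym 'f free_alg2 = "(word \<times> word) \<Rightarrow>\<^sub>0 'f"

definition free_c :: "'f::field free_alg" where
  "free_c = Poly_Mapping.single (Word [GenC]) 1"

definition free_v :: "'f::field free_alg" where
  "free_v = Poly_Mapping.single (Word [GenV]) 1"

definition free_scalar :: "'f::field \<Rightarrow> 'f free_alg" where
  "free_scalar a = Poly_Mapping.single 0 a"

definition taft_ideal :: "nat \<Rightarrow> 'f::field \<Rightarrow> 'f free_alg set" where
  "taft_ideal m z = genideal ring_of_type_algebra
     {free_c ^ m - 1, free_v ^ m, free_v * free_c - free_scalar z * free_c * free_v}"

definition taft :: "nat \<Rightarrow> 'f::field \<Rightarrow> 'f free_alg set ring" where
  "taft m z = ring_of_type_algebra Quot taft_ideal m z"

definition taft_class :: "nat \<Rightarrow> 'f::field \<Rightarrow> 'f free_alg \<Rightarrow> 'f free_alg set" where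
  "taft_class m z p = taft_ideal m z +>\<^bsub>ring_of_type_algebra\<^esub> p"

definition taft_c :: "nat \<Rightarrow> 'f::field \<Rightarrow> 'f free_alg set" where
  "taft_c m z = taft_class m z free_c"

definition taft_v :: "nat \<Rightarrow> 'f::field \<Rightarrow> 'f free_alg set" where
  "taft_v m z = taft_class m z free_v"

definition taft_scalar :: "nat \<Rightarrow> 'f::field \<Rightarrow> 'f \<Rightarrow> 'f free_alg set" where
  "taft_scalar m z a = taft_class m z (free_scalar a)"


subsection \<open>The tensor square and the comultiplication\<close>

definition free_tensor :: "'f::field free_alg \<Rightarrow> 'f free_alg \<Rightarrow> 'f free_alg2" where
  "free_tensor p q =
     (\<Sum>x\<in>Poly_Mapping.keys p. \<Sum>y\<in>Poly_Mapping.keys q. Poly_Mapping.single (x, y) (Poly_Mapping.lookup p x * Poly_Mapping.lookup q y))"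

text \<open>
  With \<open>A\<close> the free algebra and \<open>I\<close> the Taft ideal, \<open>A/I \<otimes> A/I\<close> is the quotient of \<open>A \<otimes> A\<close> by
  \<open>I \<otimes> A + A \<otimes> I\<close>, the ideal generated by \<open>I \<otimes> 1\<close> and \<open>1 \<otimes> I\<close>.
\<close>

definition taft2_ideal :: "nat \<Rightarrow> 'f::field \<Rightarrow> 'f free_alg2 set" where
  "taft2_ideal m z = genideal ring_of_type_algebra
     ((\<lambda>p. free_tensor p 1) ` taft_ideal m z \<union> (\<lambda>p. free_tensor 1 p) ` taft_ideal m z)"

definition taft2 :: "nat \<Rightarrow> 'f::field \<Rightarrow> 'f free_alg2 set ring" where
  "taft2 m z = ring_of_type_algebra Quot taft2_ideal m z"

definition taft_tensor ::
  "nat \<Rightarrow> 'f::field \<Rightarrow> 'f free_alg set \<Rightarrow> 'f free_alg set \<Rightarrow> 'f free_alg2 set" where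
  "taft_tensor m z G H =
     (\<Union>p\<in>G. \<Union>q\<in>H. taft2_ideal m z +>\<^bsub>ring_of_type_algebra\<^esub> free_tensor p q)"

fun comult_gen :: "gen \<Rightarrow> 'f::field free_alg2" where
  "comult_gen GenC = free_tensor free_c free_c"
| "comult_gen GenV = free_tensor free_c free_v + free_tensor free_v 1"

text \<open>The algebra homomorphism from the free algebra that extends \<^const>\<open>comult_gen\<close>.\<close>

definition free_comult :: "'f::field free_alg \<Rightarrow> 'f free_alg2" where
  "free_comult p = (\<Sum>x\<in>Poly_Mapping.keys p. Poly_Mapping.single 0 (Poly_Mapping.lookup p x) *
                      prod_list (map comult_gen (letters x)))"

text \<open>
  Since \<^const>\<open>free_comult\<close> maps the Taft ideal into \<^const>\<open>taft2_ideal\<close> (for a primitive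
  \<open>m\<close>th root of unity), all the cosets in the following union coincide.
\<close>

definition taft_comult :: "nat \<Rightarrow> 'f::field \<Rightarrow> 'f free_alg set \<Rightarrow> 'f free_alg2 set" where
  "taft_comult m z h = (\<Union>p\<in>h. taft2_ideal m z +>\<^bsub>ring_of_type_algebra\<^esub> free_comult p)"

text \<open>\<open>is_sweedler m z h ts\<close>: the comultiplication of \<open>h\<close> is the sum of \<open>x \<otimes> y\<close> over the pairs
  \<open>(x, y)\<close> in the list \<open>ts\<close>.\<close>

definition is_sweedler ::
  "nat \<Rightarrow> 'f::field \<Rightarrow> 'f free_alg set \<Rightarrow> ('f free_alg set \<times> 'f free_alg set) list \<Rightarrow> bool"
where
  "is_sweedler m z h ts \<longleftrightarrow>
     set ts \<subseteq> carrier (taft m z) \<times> carrier (taft m z) \<and>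
     taft_comult m z h =
       foldr (\<lambda>(x, y) t. taft_tensor m z x y \<oplus>\<^bsub>taft2 m z\<^esub> t) ts \<zero>\<^bsub>taft2 m z\<^esub>"


section \<open>Lie algebras\<close>

text \<open>A Lie algebra whose underlying space is a subspace \<open>A\<close> of an ambient vector space; the
  bracket matters only on \<open>A\<close>.\<close>

definition lie_algebra_on ::
  "('f::field \<Rightarrow> 'a::ab_group_add \<Rightarrow> 'a) \<Rightarrow> 'a set \<Rightarrow> ('a \<Rightarrow> 'a \<Rightarrow> 'a) \<Rightarrow> bool" where
  "lie_algebra_on scale A br \<longleftrightarrow>
     vector_space scale \<and> module.subspace scale A \<and>
     (\<forall>x\<in>A. \<forall>y\<in>A. br x y \<in> A) \<and>
     (\<forall>x\<in>A. \<forall>y\<in>A. \<forall>w\<in>A. br (x + y) w = br x w + br y w) \<and>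
     (\<forall>x\<in>A. \<forall>y\<in>A. \<forall>w\<in>A. br w (x + y) = br w x + br w y) \<and>
     (\<forall>r. \<forall>x\<in>A. \<forall>y\<in>A. br (scale r x) y = scale r (br x y)) \<and>
     (\<forall>r. \<forall>x\<in>A. \<forall>y\<in>A. br x (scale r y) = scale r (br x y)) \<and>
     (\<forall>x\<in>A. br x x = 0) \<and>
     (\<forall>x\<in>A. \<forall>y\<in>A. \<forall>w\<in>A. br x (br y w) + br y (br w x) + br w (br x y) = 0)"

definition lie_ideal_on ::
  "('f::field \<Rightarrow> 'a::ab_group_add \<Rightarrow> 'a) \<Rightarrow> 'a set \<Rightarrow> ('a \<Rightarrow> 'a \<Rightarrow> 'a) \<Rightarrow> 'a set \<Rightarrow> bool" where
  "lie_ideal_on scale A br J \<longleftrightarrow>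
     module.subspace scale J \<and> J \<subseteq> A \<and> (\<forall>x\<in>A. \<forall>y\<in>J. br x y \<in> J)"

definition lie_derived ::
  "('f::field \<Rightarrow> 'a::ab_group_add \<Rightarrow> 'a) \<Rightarrow> 'a set \<Rightarrow> ('a \<Rightarrow> 'a \<Rightarrow> 'a) \<Rightarrow> 'a set" where
  "lie_derived scale A br = module.span scale {br x y | x y. x \<in> A \<and> y \<in> A}"

definition simple_lie_algebra_on ::
  "('f::field \<Rightarrow> 'a::ab_group_add \<Rightarrow> 'a) \<Rightarrow> 'a set \<Rightarrow> ('a \<Rightarrow> 'a \<Rightarrow> 'a) \<Rightarrow> bool" where
  "simple_lie_algebra_on scale A br \<longleftrightarrow>
     lie_algebra_on scale A br \<and> lie_derived scale A br \<noteq> {0} \<and>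
     (\<forall>J. lie_ideal_on scale A br J \<longrightarrow> J = {0} \<or> J = A)"


section \<open>Module Lie algebras over the Taft algebra\<close>

text \<open>The scalar clause makes the given vector space structure the one induced by the action of
  the Taft algebra.\<close>

definition taft_module ::
  "nat \<Rightarrow> 'f::field \<Rightarrow> ('f \<Rightarrow> 'a::ab_group_add \<Rightarrow> 'a) \<Rightarrow> ('f free_alg set \<Rightarrow> 'a \<Rightarrow> 'a) \<Rightarrow> bool"
where
  "taft_module m z scale act \<longleftrightarrow>
     vector_space scale \<and>
     (\<forall>h\<in>carrier (taft m z). Vector_Spaces.linear scale scale (act h)) \<and>
     (\<forall>r x. act (taft_scalar m z r) x = scale r x) \<and>
     (\<forall>x. act \<one>\<^bsub>taft m z\<^esub> x = x) \<and>
     (\<forall>h\<in>carrier (taft m z). \<forall>k\<in>carrier (taft m z). \<forall>x.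
        act (h \<oplus>\<^bsub>taft m z\<^esub> k) x = act h x + act k x) \<and>
     (\<forall>h\<in>carrier (taft m z). \<forall>k\<in>carrier (taft m z). \<forall>x.
        act (h \<otimes>\<^bsub>taft m z\<^esub> k) x = act h (act k x))"

definition taft_module_lie_algebra ::
  "nat \<Rightarrow> 'f::field \<Rightarrow> ('f \<Rightarrow> 'a::ab_group_add \<Rightarrow> 'a) \<Rightarrow> ('f free_alg set \<Rightarrow> 'a \<Rightarrow> 'a) \<Rightarrow>
   ('a \<Rightarrow> 'a \<Rightarrow> 'a) \<Rightarrow> bool" where
  "taft_module_lie_algebra m z scale act br \<longleftrightarrow>
     taft_module m z scale act \<and> lie_algebra_on scale UNIV br \<and>
     (\<forall>h\<in>carrier (taft m z). \<forall>ts. is_sweedler m z h ts \<longrightarrow>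
        (\<forall>a b. act h (br a b) = (\<Sum>(x, y)\<leftarrow>ts. br (act x a) (act y b))))"

definition taft_simple ::
  "nat \<Rightarrow> 'f::field \<Rightarrow> ('f \<Rightarrow> 'a::ab_group_add \<Rightarrow> 'a) \<Rightarrow> ('f free_alg set \<Rightarrow> 'a \<Rightarrow> 'a) \<Rightarrow>
   ('a \<Rightarrow> 'a \<Rightarrow> 'a) \<Rightarrow> bool" where
  "taft_simple m z scale act br \<longleftrightarrow>
     lie_derived scale UNIV br \<noteq> {0} \<and>
     (\<forall>J. lie_ideal_on scale UNIV br J \<and> (\<forall>h\<in>carrier (taft m z). \<forall>x\<in>J. act h x \<in> J)
        \<longrightarrow> J = {0} \<or> J = UNIV)"


section \<open>The structure on \<open>L(B, \<gamma>)\<close>\<close>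

text \<open>The whole type \<open>'a\<close> is the (internal) direct sum of the subspaces \<open>V 0, \<dots>, V (m - 1)\<close>.\<close>

definition direct_sum_decomp ::
  "('f::field \<Rightarrow> 'a::ab_group_add \<Rightarrow> 'a) \<Rightarrow> nat \<Rightarrow> (nat \<Rightarrow> 'a set) \<Rightarrow> bool" where
  "direct_sum_decomp scale m V \<longleftrightarrow>
     (\<forall>i<m. module.subspace scale (V i)) \<and>
     (\<forall>x. \<exists>!f. f \<in> (\<Pi>\<^sub>E i\<in>{..<m}. V i) \<and> x = (\<Sum>i<m. f i))"

definition LB_action ::
  "nat \<Rightarrow> 'f::field \<Rightarrow> ('f \<Rightarrow> 'a::ab_group_add \<Rightarrow> 'a) \<Rightarrow> (nat \<Rightarrow> 'a set) \<Rightarrow> ('a \<Rightarrow> 'a) \<Rightarrow>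
   ('f free_alg set \<Rightarrow> 'a \<Rightarrow> 'a) \<Rightarrow> bool" where
  "LB_action m z scale V \<phi> act \<longleftrightarrow>
     taft_module m z scale act \<and>
     (\<forall>i. i + 2 \<le> m \<longrightarrow> (\<forall>a\<in>V i. act (taft_v m z) (\<phi> a) = a)) \<and>
     (\<forall>a\<in>V 0. act (taft_v m z) a = 0) \<and>
     (\<forall>i<m. \<forall>a\<in>V i. act (taft_c m z) a = scale (z ^ i) a)"

text \<open>The commutator on \<open>L(B, \<gamma>)\<close>, where \<open>brB\<close> is the commutator of \<open>B = V 0\<close>.\<close>

definition LB_bracket ::
  "nat \<Rightarrow> 'f::field \<Rightarrow> 'f \<Rightarrow> ('f \<Rightarrow> 'a::ab_group_add \<Rightarrow> 'a) \<Rightarrow> (nat \<Rightarrow> 'a set) \<Rightarrow>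
   ('a \<Rightarrow> 'a \<Rightarrow> 'a) \<Rightarrow> ('a \<Rightarrow> 'a) \<Rightarrow> ('a \<Rightarrow> 'a \<Rightarrow> 'a) \<Rightarrow> bool" where
  "LB_bracket m z \<gamma> scale V brB \<phi> br \<longleftrightarrow>
     (\<forall>x. Vector_Spaces.linear scale scale (br x)) \<and>
     (\<forall>y. Vector_Spaces.linear scale scale (\<lambda>x. br x y)) \<and>
     (\<forall>k<m. \<forall>l<m. \<forall>a\<in>V 0. \<forall>b\<in>V 0.
        br ((\<phi> ^^ k) a) ((\<phi> ^^ l) b) =
          (if k + l < m
           then scale (qbinom z (k + l) k) ((\<phi> ^^ (k + l)) (brB a b))
           else scale (\<gamma> * (qfact z (k + l - m) / (qfact z k * qfact z l)))
                  ((\<phi> ^^ (k + l - m)) (brB a b))))"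

end

theory Submission
  imports Defs
begin

text \<open>
  Rescaling \<open>\<phi>\<^sup>k(a)\<close> by \<open>k!\<^sub>\<zeta>\<close> turns \<open>L(B, \<gamma>)\<close> into \<open>F[t]/(t\<^sup>m - \<gamma>) \<otimes> B\<close> with the bracket of a current
  algebra, on which \<open>c\<close> acts by \<open>t \<mapsto> \<zeta> t\<close> and \<open>v\<close> as the quantum derivative
  \<open>t\<^sup>n \<mapsto> n\<^sub>\<zeta> t\<^bsup>n - 1\<^esup>\<close>, which is well defined as \<open>m\<^sub>\<zeta> = 0\<close>. The Lie axioms and the skew Leibniz rule
  for \<open>v\<close> are then immediate, and the compatibility with an arbitrary element of the Taft algebra
  follows from that with the generators. For simplicity, repeatedly applying \<open>v\<close> to a nonzero element
  of an invariant ideal \<open>J\<close> ends in a nonzero element of \<open>ker v = B\<close>, so \<open>B \<subseteq> J\<close>; then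
  \<open>t\<^sup>n \<otimes> B = [t\<^sup>n \<otimes> B, B] \<subseteq> J\<close> for every \<open>n\<close>.
\<close>

section \<open>Ideals and quotients of type-class rings\<close>

lemma ring_of_type_algebra_simps [simp]:
  "carrier ring_of_type_algebra = UNIV"
  "monoid.mult ring_of_type_algebra = (*)"
  "monoid.one ring_of_type_algebra = 1"
  "add ring_of_type_algebra = (+)"
  "ring.zero ring_of_type_algebra = 0"
  by (simp_all add: ring_of_type_algebra_def)

lemma ring_ring_of_type_algebra: "ring (ring_of_type_algebra :: 'r::ring_1 ring)"
proof (rule ringI)
  have "\<exists>y. x + y = 0" for x :: 'r
    by (rule exI[of _ "- x"]) simp
  then show "abelian_group (ring_of_type_algebra :: 'r ring)"
    by (auto intro!: abelian_groupI simp: add.assoc add.commute add.left_commute)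
qed (auto intro!: monoidI simp: algebra_simps)

lemma ideal_ring_of_type_algebraI:
  fixes K :: "'r::ring_1 set"
  assumes "0 \<in> K" and "\<And>a b. a \<in> K \<Longrightarrow> b \<in> K \<Longrightarrow> a + b \<in> K" and "\<And>a. a \<in> K \<Longrightarrow> - a \<in> K"
    and "\<And>a x. a \<in> K \<Longrightarrow> x * a \<in> K" and "\<And>a x. a \<in> K \<Longrightarrow> a * x \<in> K"
  shows "ideal K ring_of_type_algebra"
proof (rule idealI)
  interpret R: ring "ring_of_type_algebra :: 'r ring"
    by (rule ring_ring_of_type_algebra)
  have uminus: "\<ominus>\<^bsub>ring_of_type_algebra\<^esub> a = - a" for a :: 'r
    by (rule R.minus_equality) auto
  show "subgroup K (add_monoid (ring_of_type_algebra :: 'r ring))"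
  proof (rule R.add.subgroupI)
  qed (use assms uminus in auto)
qed (use assms ring_ring_of_type_algebra in auto)

lemma a_r_coset_ring_of_type_algebra:
  "I +>\<^bsub>ring_of_type_algebra\<^esub> p = (\<lambda>i. i + p) ` I"
  by (auto simp: a_r_coset_def')

lemma ideal_taft_ideal: "ideal (taft_ideal m z) ring_of_type_algebra"
  unfolding taft_ideal_def by (rule ring.genideal_ideal[OF ring_ring_of_type_algebra]) simp

lemma ideal_taft2_ideal: "ideal (taft2_ideal m z) ring_of_type_algebra"
  unfolding taft2_ideal_def by (rule ring.genideal_ideal[OF ring_ring_of_type_algebra]) simp

lemma zero_in_ideal:
  assumes "ideal (I :: 'r::ring_1 set) ring_of_type_algebra"
  shows "0 \<in> I"
  using additive_subgroup.zero_closed[OF ideal.axioms(1)[OF assms]] by simp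

section \<open>Cosets of the Taft ideal and the projection onto the Taft algebra\<close>

lemma taft_class_conv_image: "taft_class m z p = (\<lambda>i. i + p) ` taft_ideal m z"
  by (simp add: taft_class_def a_r_coset_ring_of_type_algebra)

lemma taft_class_self: "p \<in> taft_class m z p"
  using zero_in_ideal[OF ideal_taft_ideal[of m z]] by (force simp: taft_class_conv_image)

lemma taft_class_hom: "taft_class m z \<in> ring_hom ring_of_type_algebra (taft m z)"
  using ideal.rcos_ring_hom[OF ideal_taft_ideal] by (simp add: taft_class_def[abs_def] taft_def)

lemma taft_class_in_carrier: "taft_class m z p \<in> carrier (taft m z)"
  using ring_hom_closed[OF taft_class_hom] by simp

lemma taft_class_add: "taft_class m z (p + q) = taft_class m z p \<oplus>\<^bsub>taft m z\<^esub> taft_class m z q"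
  using ring_hom_add[OF taft_class_hom, of p q m z] by simp

lemma taft_class_mult: "taft_class m z (p * q) = taft_class m z p \<otimes>\<^bsub>taft m z\<^esub> taft_class m z q"
  using ring_hom_mult[OF taft_class_hom, of p q m z] by simp

lemma taft_class_one: "taft_class m z 1 = \<one>\<^bsub>taft m z\<^esub>"
  using ring_hom_one[OF taft_class_hom, of m z] by simp

lemma taft_carrierE:
  assumes "h \<in> carrier (taft m z)"
  obtains p where "h = taft_class m z p"
  using assms by (auto simp: taft_def FactRing_def A_RCOSETS_def' taft_class_def)

lemma taft_class_eqI:
  assumes "p \<in> taft_ideal m z"
  shows "taft_class m z p = taft_class m z 0"
proof -
  interpret ideal "taft_ideal m z" ring_of_type_algebra
    by (rule ideal_taft_ideal)
  show ?thesis
    using a_rcos_const[OF assms] a_rcos_const[OF zero_in_ideal[OF ideal_taft_ideal]] by (simp add: taft_class_def)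
qed


section \<open>Linear extension from a basis of monomials\<close>

definition lin_ext ::
  "('f::field \<Rightarrow> 'l::ab_group_add \<Rightarrow> 'l) \<Rightarrow> ('w \<Rightarrow> 'l) \<Rightarrow> ('w \<Rightarrow>\<^sub>0 'f) \<Rightarrow> 'l" where
  "lin_ext scale f p = (\<Sum>x\<in>Poly_Mapping.keys p. scale (Poly_Mapping.lookup p x) (f x))"

lemma poly_mapping_sum_single:
  fixes p :: "'w \<Rightarrow>\<^sub>0 'c::comm_monoid_add"
  shows "p = (\<Sum>x\<in>Poly_Mapping.keys p. Poly_Mapping.single x (Poly_Mapping.lookup p x))"
  by (rule poly_mapping_eqI)
    (auto simp: lookup_sum lookup_single when_def in_keys_iff sum.delta')

lemma poly_mapping_induct [case_names zero single add]:
  fixes p :: "'w \<Rightarrow>\<^sub>0 'c::comm_monoid_add"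
  assumes "P 0" and "\<And>x r. P (Poly_Mapping.single x r)" and "\<And>p q. P p \<Longrightarrow> P q \<Longrightarrow> P (p + q)"
  shows "P p"
proof -
  have "P (\<Sum>x\<in>A. Poly_Mapping.single x (Poly_Mapping.lookup p x))" if "finite A" for A
    using that by induction (auto intro: assms)
  then show ?thesis
    using poly_mapping_sum_single[of p] by (metis finite_keys)
qed

lemma linear_iff_maps:
  assumes "vector_space scale"
  shows "Vector_Spaces.linear scale scale f \<longleftrightarrow>
    (\<forall>x y. f (x + y) = f x + f y) \<and> (\<forall>r x. f (scale r x) = scale r (f x))"
  using assms by (simp add: linear_iff_module_hom module_hom_iff module_iff_vector_space)

definition bilin :: "('f::field \<Rightarrow> 'l::ab_group_add \<Rightarrow> 'l) \<Rightarrow> ('l \<Rightarrow> 'l \<Rightarrow> 'l) \<Rightarrow> bool" where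
  "bilin scale \<beta> \<longleftrightarrow> (\<forall>x. Vector_Spaces.linear scale scale (\<beta> x)) \<and>
     (\<forall>y. Vector_Spaces.linear scale scale (\<lambda>x. \<beta> x y))"

context vector_space
begin

lemma linear_zero: "Vector_Spaces.linear scale scale f \<Longrightarrow> f 0 = 0"
  by (simp add: linear_iff_module_hom module_hom.zero)

lemma bilin_zero_left: "bilin scale \<beta> \<Longrightarrow> \<beta> 0 b = 0"
  using linear_zero[of "\<lambda>x. \<beta> x b"] by (simp add: bilin_def)

lemma bilin_zero_right: "bilin scale \<beta> \<Longrightarrow> \<beta> a 0 = 0"
  using linear_zero[of "\<beta> a"] by (simp add: bilin_def)

lemma lin_ext_superset:
  assumes "finite S" "Poly_Mapping.keys p \<subseteq> S"
  shows "lin_ext scale f p = (\<Sum>x\<in>S. scale (Poly_Mapping.lookup p x) (f x))"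
  unfolding lin_ext_def using assms by (intro sum.mono_neutral_left) (auto simp: in_keys_iff)

lemma lin_ext_zero [simp]: "lin_ext scale f 0 = 0"
  by (simp add: lin_ext_def)

lemma lin_ext_add: "lin_ext scale f (p + q) = lin_ext scale f p + lin_ext scale f q"
proof -
  let ?S = "Poly_Mapping.keys p \<union> Poly_Mapping.keys q"
  have "Poly_Mapping.keys (p + q) \<subseteq> ?S"
    by (rule keys_add)
  then show ?thesis
    by (simp add: lin_ext_superset[of ?S] lookup_add scale_left_distrib sum.distrib)
qed

lemma lin_ext_uminus: "lin_ext scale f (- p) = - lin_ext scale f p"
  using lin_ext_add[of f p "- p"] by (simp add: eq_neg_iff_add_eq_0 add.commute)

lemma lin_ext_diff: "lin_ext scale f (p - q) = lin_ext scale f p - lin_ext scale f q"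
  using lin_ext_add[of f p "- q"] by (simp add: lin_ext_uminus)

lemma lin_ext_sum: "lin_ext scale f (\<Sum>i\<in>I. g i) = (\<Sum>i\<in>I. lin_ext scale f (g i))"
  by (induction I rule: infinite_finite_induct) (auto simp: lin_ext_add)

lemma lin_ext_single [simp]: "lin_ext scale f (Poly_Mapping.single x r) = scale r (f x)"
  by (cases "r = 0") (auto simp: lin_ext_def)

lemma lin_ext_one: "lin_ext scale f 1 = f 0"
  using lin_ext_single[of f 0 1] by simp

lemma linear_lin_ext:
  assumes "Vector_Spaces.linear scale scale g"
  shows "g (lin_ext scale f p) = lin_ext scale (\<lambda>x. g (f x)) p"
proof -
  interpret g: Vector_Spaces.linear scale scale g by fact
  show ?thesis
    by (simp add: lin_ext_def g.sum g.scale)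
qed

lemma lin_ext_fun_add:
  "lin_ext scale (\<lambda>x. f x + g x) p = lin_ext scale f p + lin_ext scale g p"
  by (simp add: lin_ext_def scale_right_distrib sum.distrib)

lemma lin_ext_fun_scale: "lin_ext scale (\<lambda>x. scale r (f x)) p = scale r (lin_ext scale f p)"
  by (simp add: lin_ext_def scale_sum_right mult.commute)

lemma lin_ext_mult:
  "lin_ext scale f (p * q) = lin_ext scale (\<lambda>x. lin_ext scale (\<lambda>y. f (x + y)) q) p"
proof (induction p rule: poly_mapping_induct)
  case (single x r)
  show ?case
    by (induction q rule: poly_mapping_induct)
      (simp_all add: mult_single lin_ext_add ring_distribs scale_right_distrib)
qed (simp_all add: lin_ext_add ring_distribs)

text \<open>The opposite order of summation keeps \<open>p\<close> together, so that a property of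
  \<open>p\<close> can be applied inside the sum over \<open>q\<close>.\<close>

lemma lin_ext_mult':
  "lin_ext scale f (p * q) = lin_ext scale (\<lambda>y. lin_ext scale (\<lambda>x. f (x + y)) p) q"
proof (induction q rule: poly_mapping_induct)
  case (single x r)
  show ?case
    by (induction p rule: poly_mapping_induct)
      (simp_all add: mult_single lin_ext_add ring_distribs scale_right_distrib mult.commute)
qed (simp_all add: lin_ext_add ring_distribs)

end


section \<open>Actions of the free algebra and of its tensor square\<close>

text \<open>\<open>foldr\<close> lets the last letter act first, so concatenation of words becomes
  composition, as for a left module.\<close>

definition word_act :: "(gen \<Rightarrow> 'l \<Rightarrow> 'l) \<Rightarrow> word \<Rightarrow> 'l \<Rightarrow> 'l" where
  "word_act g w = foldr g (letters w)"

lemma word_act_zero [simp]: "word_act g 0 x = x"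
  by (simp add: word_act_def zero_word_def)

lemma word_act_add: "word_act g (w + w') x = word_act g w (word_act g w' x)"
  by (simp add: word_act_def plus_word_def)

lemma word_act_gen [simp]: "word_act g (Word [s]) x = g s x"
  by (simp add: word_act_def)

definition free_act ::
  "('f::field \<Rightarrow> 'l::ab_group_add \<Rightarrow> 'l) \<Rightarrow> (gen \<Rightarrow> 'l \<Rightarrow> 'l) \<Rightarrow> 'f free_alg \<Rightarrow> 'l \<Rightarrow> 'l" where
  "free_act scale g p x = lin_ext scale (\<lambda>w. word_act g w x) p"

text \<open>This is the action of \<open>q\<close> on the tensor of \<open>a\<close> and
  \<open>b\<close>, followed by the linear map that \<open>\<beta>\<close> induces on the tensor
  square; in this form the tensor square of the module need not be built.\<close>

definition tensor_act ::
  "('f::field \<Rightarrow> 'l::ab_group_add \<Rightarrow> 'l) \<Rightarrow> (gen \<Rightarrow> 'l \<Rightarrow> 'l) \<Rightarrow> ('l \<Rightarrow> 'l \<Rightarrow> 'l) \<Rightarrow>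
   'f free_alg2 \<Rightarrow> 'l \<Rightarrow> 'l \<Rightarrow> 'l" where
  "tensor_act scale g \<beta> q a b =
     lin_ext scale (\<lambda>w. \<beta> (word_act g (fst w) a) (word_act g (snd w) b)) q"

locale generator_action = vector_space scale
  for scale :: "'f::field \<Rightarrow> 'l::ab_group_add \<Rightarrow> 'l" +
  fixes g :: "gen \<Rightarrow> 'l \<Rightarrow> 'l"
  assumes linear_gen: "Vector_Spaces.linear scale scale (g s)"
begin

lemma linear_word_act: "Vector_Spaces.linear scale scale (word_act g w)"
proof -
  have "Vector_Spaces.linear scale scale (foldr g ws)" for ws
  proof (induction ws)
    case Nil
    show ?case
      using linear_id by (simp add: id_def)
  next
    case (Cons s ws)
    then show ?case
      using linear_gen[of s] by (simp add: linear_iff_maps[OF vector_space_axioms])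
  qed
  then show ?thesis
    by (simp add: word_act_def)
qed

lemma linear_free_act: "Vector_Spaces.linear scale scale (free_act scale g p)"
  using linear_word_act
  by (simp add: linear_iff_maps[OF vector_space_axioms] free_act_def lin_ext_fun_add lin_ext_fun_scale)

lemma free_act_mult: "free_act scale g (p * q) x = free_act scale g p (free_act scale g q x)"
  by (simp add: free_act_def lin_ext_mult word_act_add linear_lin_ext[OF linear_word_act])

lemma free_act_add: "free_act scale g (p + q) x = free_act scale g p x + free_act scale g q x"
  by (simp add: free_act_def lin_ext_add)

lemma free_act_diff: "free_act scale g (p - q) x = free_act scale g p x - free_act scale g q x"
  by (simp add: free_act_def lin_ext_diff)

lemma free_act_uminus: "free_act scale g (- p) x = - free_act scale g p x"
  by (simp add: free_act_def lin_ext_uminus)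

lemma free_act_one [simp]: "free_act scale g 1 x = x"
  by (simp add: free_act_def lin_ext_one)

lemma free_act_power: "free_act scale g (p ^ n) x = (free_act scale g p ^^ n) x"
  by (induction n) (simp_all add: free_act_mult)

lemma free_act_simps [simp]:
  "free_act scale g 0 x = 0"
  "free_act scale g free_c x = g GenC x"
  "free_act scale g free_v x = g GenV x"
  "free_act scale g (free_scalar r) x = scale r x"
  by (simp_all add: free_act_def free_c_def free_v_def free_scalar_def)

text \<open>The elements acting as zero form a two-sided ideal. The hypotheses put the three
  generators of the Taft ideal into it, and a generated ideal is the least one containing its
  generators.\<close>

lemma free_act_taft_ideal:
  assumes "\<And>x. (g GenC ^^ m) x = x" "\<And>x. (g GenV ^^ m) x = 0"
    and "\<And>x. g GenV (g GenC x) = scale z (g GenC (g GenV x))"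
    and "p \<in> taft_ideal m z"
  shows "free_act scale g p x = 0"
proof -
  let ?K = "{p. \<forall>x. free_act scale g p x = 0}"
  have "ideal ?K ring_of_type_algebra"
  proof (rule ideal_ring_of_type_algebraI)
    show "x * a \<in> ?K" if "a \<in> ?K" for a x
      using that linear_zero[OF linear_free_act[of x]] by (simp add: free_act_mult)
  qed (auto simp: free_act_mult free_act_add free_act_uminus)
  moreover have "{free_c ^ m - 1, free_v ^ m, free_v * free_c - free_scalar z * free_c * free_v} \<subseteq> ?K"
  proof -
    have "free_act scale g free_c = g GenC" "free_act scale g free_v = g GenV"
      by auto
    then show ?thesis
      using assms by (simp add: free_act_mult free_act_diff free_act_power)
  qed
  ultimately have "taft_ideal m z \<subseteq> ?K"
    unfolding taft_ideal_def by (rule ring.genideal_minimal[OF ring_ring_of_type_algebra])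
  then show ?thesis
    using assms(4) by auto
qed

lemma bilin_word_act:
  assumes "bilin scale \<beta>"
  shows "bilin scale (\<lambda>a b. \<beta> (word_act g u a) (word_act g w b))"
  using assms linear_word_act by (simp add: bilin_def linear_iff_maps[OF vector_space_axioms])

section \<open>The tensor square acting through a bilinear map\<close>

lemma tensor_act_add:
  "tensor_act scale g \<beta> (p + q) a b = tensor_act scale g \<beta> p a b + tensor_act scale g \<beta> q a b"
  by (simp add: tensor_act_def lin_ext_add)

lemma tensor_act_uminus: "tensor_act scale g \<beta> (- p) a b = - tensor_act scale g \<beta> p a b"
  by (simp add: tensor_act_def lin_ext_uminus)

lemma tensor_act_zero: "tensor_act scale g \<beta> 0 a b = 0"
  by (simp add: tensor_act_def)

text \<open>The left factor acts last, next to \<open>\<beta>\<close>, so it changes the bilinear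
  map; in \<open>tensor_act_mult_right\<close> the right factor acts first and changes the
  arguments.\<close>

lemma tensor_act_mult_left:
  "tensor_act scale g \<beta> (p * q) a b =
    lin_ext scale (\<lambda>u. tensor_act scale g (\<lambda>a b. \<beta> (word_act g (fst u) a) (word_act g (snd u) b)) q a b) p"
  by (simp add: tensor_act_def lin_ext_mult word_act_add)

lemma tensor_act_mult_right:
  "tensor_act scale g \<beta> (p * q) a b =
    lin_ext scale (\<lambda>u. tensor_act scale g \<beta> p (word_act g (fst u) a) (word_act g (snd u) b)) q"
  by (simp add: tensor_act_def lin_ext_mult' word_act_add)

lemma tensor_act_free_tensor:
  assumes "bilin scale \<beta>"
  shows "tensor_act scale g \<beta> (free_tensor p q) a b = \<beta> (free_act scale g p a) (free_act scale g q b)"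
proof -
  have l: "Vector_Spaces.linear scale scale (\<beta> x)" and r: "Vector_Spaces.linear scale scale (\<lambda>x. \<beta> x y)" for x y
    using assms by (auto simp: bilin_def)
  show ?thesis
    unfolding free_act_def linear_lin_ext[OF r] linear_lin_ext[OF l]
    by (simp add: tensor_act_def free_tensor_def lin_ext_sum lin_ext_def[of scale _ p]
        lin_ext_def[of scale _ q] scale_sum_right mult.commute sum.swap[of _ "Poly_Mapping.keys q"])
qed

text \<open>The kernel is taken over all bilinear maps at once, since for a single one it would only be a
  right ideal.\<close>

lemma tensor_act_taft2_ideal:
  assumes "\<And>p x. p \<in> taft_ideal m z \<Longrightarrow> free_act scale g p x = 0"
    and "q \<in> taft2_ideal m z" and "bilin scale \<beta>"
  shows "tensor_act scale g \<beta> q a b = 0"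
proof -
  let ?K = "{q. \<forall>\<beta> a b. bilin scale \<beta> \<longrightarrow> tensor_act scale g \<beta> q a b = 0}"
  have "ideal ?K ring_of_type_algebra"
  proof (rule ideal_ring_of_type_algebraI)
    show "x * q \<in> ?K" if "q \<in> ?K" for q x
      using that bilin_word_act by (simp add: tensor_act_mult_left lin_ext_def)
    show "q * x \<in> ?K" if "q \<in> ?K" for q x
      using that by (simp add: tensor_act_mult_right lin_ext_def)
  qed (auto simp: tensor_act_add tensor_act_uminus tensor_act_zero)
  moreover have "(\<lambda>p. free_tensor p 1) ` taft_ideal m z \<union> (\<lambda>p. free_tensor 1 p) ` taft_ideal m z \<subseteq> ?K"
    using assms(1)
    by (auto simp: tensor_act_free_tensor bilin_zero_left bilin_zero_right)
  ultimately have "taft2_ideal m z \<subseteq> ?K"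
    unfolding taft2_ideal_def by (rule ring.genideal_minimal[OF ring_ring_of_type_algebra])
  then show ?thesis
    using assms(2,3) by auto
qed

text \<open>The hypothesis on generators is the case of one-letter words; multiplicativity carries
  it to all words and linearity to the whole free algebra.\<close>

lemma tensor_act_free_comult:
  assumes "bilin scale \<beta>"
    and "\<And>s a b. g s (\<beta> a b) = tensor_act scale g \<beta> (comult_gen s) a b"
  shows "tensor_act scale g \<beta> (free_comult p) a b = free_act scale g p (\<beta> a b)"
proof -
  have *: "tensor_act scale g \<beta> (prod_list (map comult_gen ws)) a b = foldr g ws (\<beta> a b)" for ws
  proof (induction ws)
    case Nil
    show ?case
      by (simp add: tensor_act_def lin_ext_one)
  next
    case (Cons s ws)
    have "foldr g (s # ws) (\<beta> a b) = g s (tensor_act scale g \<beta> (prod_list (map comult_gen ws)) a b)"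
      by (simp add: Cons)
    \<comment> \<open>The right factor only changes the arguments of \<open>\<beta>\<close>, term by
      term. The rule for \<open>s\<close> holds in each term, and linearity takes \<open>g s\<close>
      out of the sum.\<close>
    also have "\<dots> = tensor_act scale g \<beta> (prod_list (map comult_gen (s # ws))) a b"
      by (simp only: list.map prod_list.Cons tensor_act_mult_right assms(2)[symmetric])
        (simp add: tensor_act_def linear_lin_ext[OF linear_gen])
    finally show ?case ..
  qed
  have "tensor_act scale g \<beta> (Poly_Mapping.single 0 r * q) a b = scale r (tensor_act scale g \<beta> q a b)" for r q
    by (simp add: tensor_act_mult_left)
  then show ?thesis
    by (simp add: free_comult_def free_act_def lin_ext_def[of _ _ p] word_act_def * [symmetric])
      (simp add: tensor_act_def lin_ext_sum)
qed

end


section \<open>Modules over the Taft algebra\<close>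

lemma set_add_ring_of_type_algebra:
  "set_add ring_of_type_algebra A C = {a + c | a c. a \<in> A \<and> c \<in> C}"
  by (auto simp: set_add_def')

definition taft_gen_act :: "nat \<Rightarrow> 'f::field \<Rightarrow> ('f free_alg set \<Rightarrow> 'l \<Rightarrow> 'l) \<Rightarrow> gen \<Rightarrow> 'l \<Rightarrow> 'l" where
  "taft_gen_act m z act s = act (case s of GenC \<Rightarrow> taft_c m z | GenV \<Rightarrow> taft_v m z)"

lemma generator_action_taft_gen_act:
  assumes "taft_module m z scale act"
  shows "generator_action scale (taft_gen_act m z act)"
  using assms taft_class_in_carrier[of m z]
  by (auto simp: taft_module_def generator_action_def generator_action_axioms_def taft_gen_act_def
      taft_c_def taft_v_def split: gen.splits)

text \<open>A module is determined by the operators of \<open>c\<close> and \<open>v\<close>: their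
  products give the action of words, and the scalar clause that of the coefficients.\<close>

lemma taft_module_act_class:
  assumes act: "taft_module m z scale act"
  shows "act (taft_class m z p) x = free_act scale (taft_gen_act m z act) p x"
proof -
  interpret generator_action scale "taft_gen_act m z act"
    using act by (rule generator_action_taft_gen_act)
  have mult: "act (taft_class m z (p * q)) x = act (taft_class m z p) (act (taft_class m z q) x)"
    and sum: "act (taft_class m z (p + q)) x = act (taft_class m z p) x + act (taft_class m z q) x"
    and scalar: "act (taft_class m z (free_scalar r)) x = scale r x"
    and one: "act (taft_class m z 1) x = x" for p q r x
    using act by (auto simp: taft_module_def taft_class_mult taft_class_add taft_class_one
        taft_class_in_carrier taft_scalar_def)
  have word: "act (taft_class m z (Poly_Mapping.single (Word ws) 1)) x =
      foldr (taft_gen_act m z act) ws x" for ws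
  proof (induction ws)
    case Nil
    show ?case
      using one by (simp flip: zero_word_def)
  next
    case (Cons s ws)
    have "Poly_Mapping.single (Word (s # ws)) 1 =
      Poly_Mapping.single (Word [s]) (1::'a) * Poly_Mapping.single (Word ws) 1"
      by (simp add: mult_single plus_word_def)
    then show ?case
      by (cases s) (simp_all add: mult Cons taft_gen_act_def taft_c_def taft_v_def free_c_def free_v_def)
  qed
  show ?thesis
  proof (induction p rule: poly_mapping_induct)
    case zero
    show ?case
      using scalar[of 0 x] by (simp add: free_scalar_def)
  next
    case (single w r)
    have "Poly_Mapping.single w r = free_scalar r * Poly_Mapping.single w 1"
      by (simp add: mult_single free_scalar_def)
    then have "act (taft_class m z (Poly_Mapping.single w r)) x = scale r (word_act (taft_gen_act m z act) w x)"
      using word[of "letters w"] by (simp add: mult scalar word_act_def)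
    then show ?case
      by (simp add: free_act_def)
  next
    case (add p q)
    then show ?case
      by (simp add: sum free_act_add)
  qed
qed

text \<open>Elements of \<open>taft2_ideal\<close> act as zero, so all representatives of the
  comultiplication of \<open>h\<close> give the same value. A representative built from the
  generators gives the left side, one built from the Sweedler terms the right side.\<close>

lemma taft_module_sweedler:
  assumes act: "taft_module m z scale act" and br: "bilin scale br"
    and c: "\<And>a b. act (taft_c m z) (br a b) = br (act (taft_c m z) a) (act (taft_c m z) b)"
    and v: "\<And>a b. act (taft_v m z) (br a b) =
      br (act (taft_c m z) a) (act (taft_v m z) b) + br (act (taft_v m z) a) b"
    and h: "h \<in> carrier (taft m z)" and ts: "is_sweedler m z h ts"
  shows "act h (br a b) = (\<Sum>(x, y)\<leftarrow>ts. br (act x a) (act y b))"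
proof -
  let ?g = "taft_gen_act m z act"
  interpret generator_action scale ?g
    using act by (rule generator_action_taft_gen_act)
  let ?t = "\<lambda>q. tensor_act scale ?g br q a b"
  have ideal0: "free_act scale ?g p x = 0" if "p \<in> taft_ideal m z" for p x
    using taft_class_eqI[OF that] taft_module_act_class[OF act, of _ x]
    by (metis free_act_simps(1))
  have ideal2: "?t q = 0" if "q \<in> taft2_ideal m z" for q
    using tensor_act_taft2_ideal[OF ideal0 that br] .
  have class_elem: "act h x = free_act scale ?g p x" if "h \<in> carrier (taft m z)" "p \<in> h" for h p x
  proof -
    obtain q where q: "h = taft_class m z q"
      using \<open>h \<in> carrier (taft m z)\<close> by (rule taft_carrierE)
    then obtain i where "i \<in> taft_ideal m z" "p = i + q"
      using \<open>p \<in> h\<close> by (auto simp: taft_class_conv_image)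
    then show ?thesis
      by (simp add: q taft_module_act_class[OF act] free_act_add ideal0)
  qed
  obtain p where p: "h = taft_class m z p"
    using h by (rule taft_carrierE)
  have "?g s (br a b) = tensor_act scale ?g br (comult_gen s) a b" for s a b
    using br by (cases s)
      (simp_all add: tensor_act_add tensor_act_free_tensor taft_gen_act_def c v)
  then have "?t (free_comult p) = act h (br a b)"
    using br by (simp add: tensor_act_free_comult p taft_module_act_class[OF act])
  moreover have tensor: "?t r = br (act x a) (act y b)"
    if "x \<in> carrier (taft m z)" "y \<in> carrier (taft m z)" "r \<in> taft_tensor m z x y" for x y r
    using that br
    by (auto simp: taft_tensor_def a_r_coset_ring_of_type_algebra tensor_act_add ideal2
        tensor_act_free_tensor class_elem)
  \<comment> \<open>Addition in the quotient adds cosets elementwise, so every element of the sum of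
    cosets can be evaluated term by term.\<close>
  have "?t r = (\<Sum>(x, y)\<leftarrow>ts. br (act x a) (act y b))"
    if "set ts \<subseteq> carrier (taft m z) \<times> carrier (taft m z)"
      "r \<in> foldr (\<lambda>(x, y) t. taft_tensor m z x y \<oplus>\<^bsub>taft2 m z\<^esub> t) ts \<zero>\<^bsub>taft2 m z\<^esub>" for r
    using that
  proof (induction ts arbitrary: r)
    case Nil
    then show ?case
      by (simp add: taft2_def FactRing_def ideal2)
  next
    case (Cons xy ts)
    then show ?case
      by (cases xy) (auto simp: taft2_def FactRing_def set_add_ring_of_type_algebra tensor_act_add tensor)
  qed
  \<comment> \<open>\<open>is_sweedler\<close> identifies this set with the sum of cosets, so both
    evaluations apply to the same element.\<close>
  moreover have "free_comult p \<in> taft_comult m z h"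
    using zero_in_ideal[OF ideal_taft2_ideal[of m z]] taft_class_self[of p m z]
    by (force simp: taft_comult_def a_r_coset_ring_of_type_algebra p)
  ultimately show ?thesis
    using ts by (simp add: is_sweedler_def)
qed

text \<open>The operators extend to an action of the free algebra. By the Taft relations the Taft
  ideal acts as zero, so the action descends to cosets.\<close>

lemma ex_taft_module:
  fixes scale :: "'f::field \<Rightarrow> 'l::ab_group_add \<Rightarrow> 'l"
  assumes "vector_space scale"
    and "Vector_Spaces.linear scale scale C" and "Vector_Spaces.linear scale scale D"
    and "\<And>x. (C ^^ m) x = x" "\<And>x. (D ^^ m) x = 0" "\<And>x. D (C x) = scale z (C (D x))"
  shows "\<exists>act. taft_module m z scale act \<and> act (taft_c m z) = C \<and> act (taft_v m z) = D"
proof -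
  let ?g = "\<lambda>s. case s of GenC \<Rightarrow> C | GenV \<Rightarrow> D"
  interpret generator_action scale ?g
    using assms by (auto simp: generator_action_def generator_action_axioms_def split: gen.splits)
  have ideal0: "free_act scale ?g p x = 0" if "p \<in> taft_ideal m z" for p x
    using free_act_taft_ideal[OF _ _ _ that] assms by simp
  \<comment> \<open>Any representative serves: two of them differ by an element of the ideal, which
    acts as zero.\<close>
  define act where "act h = free_act scale ?g (SOME p. p \<in> h)" for h :: "'f free_alg set"
  have act: "act (taft_class m z p) x = free_act scale ?g p x" for p x
  proof -
    have "(SOME q. q \<in> taft_class m z p) \<in> taft_class m z p"
      by (rule someI) (rule taft_class_self)
    then obtain i where "i \<in> taft_ideal m z" "(SOME q. q \<in> taft_class m z p) = i + p"
      by (auto simp: taft_class_conv_image)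
    then show ?thesis
      by (simp add: act_def free_act_add ideal0)
  qed
  have "taft_module m z scale act"
    unfolding taft_module_def
  proof (intro conjI ballI allI)
    show "Vector_Spaces.linear scale scale (act h)" for h
      by (simp add: act_def linear_free_act)
    show "act (taft_scalar m z r) x = scale r x" for r x
      by (simp add: taft_scalar_def act)
    show "act \<one>\<^bsub>taft m z\<^esub> x = x" for x
      by (simp add: act flip: taft_class_one)
    show "act (h \<oplus>\<^bsub>taft m z\<^esub> k) x = act h x + act k x"
      if "h \<in> carrier (taft m z)" "k \<in> carrier (taft m z)" for h k x
      using that by (auto elim!: taft_carrierE simp: act free_act_add simp flip: taft_class_add)
    show "act (h \<otimes>\<^bsub>taft m z\<^esub> k) x = act h (act k x)"
      if "h \<in> carrier (taft m z)" "k \<in> carrier (taft m z)" for h k x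
      using that by (auto elim!: taft_carrierE simp: act free_act_mult simp flip: taft_class_mult)
  qed (rule assms)
  moreover have "act (taft_c m z) = C" "act (taft_v m z) = D"
    by (auto simp: taft_c_def taft_v_def act)
  ultimately show ?thesis
    by blast
qed


section \<open>Quantum integers at a root of unity\<close>

lemma qint_0 [simp]: "qint z 0 = 0"
  by (simp add: qint_def)

lemma qfact_0 [simp]: "qfact z 0 = 1"
  by (simp add: qfact_def)

lemma qfact_Suc: "qfact z (Suc n) = qint z (Suc n) * qfact z n"
  by (simp add: qfact_def mult.commute)

lemma qint_add: "qint z (k + l) = qint z k + z ^ k * qint z l"
  by (induction l) (simp_all add: qint_def power_add algebra_simps)

lemma qint_geometric: "(z - 1) * qint z n = z ^ n - 1"
  by (induction n) (simp_all add: qint_def algebra_simps)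

context
  fixes m :: nat and z :: "'f::field"
  assumes prim: "prim_root_unity m z" and m: "2 \<le> m"
begin

lemma prim_root_power: "z ^ m = 1"
  using prim by (simp add: prim_root_unity_def)

lemma prim_root_neq_1: "z \<noteq> 1"
  using prim m by (force simp: prim_root_unity_def dest: spec[of _ 1])

lemma qint_root [simp]: "qint z m = 0"
  using qint_geometric[of z m] prim_root_power prim_root_neq_1 by simp

text \<open>By \<open>qint_geometric\<close>, a vanishing quantum integer would give
  \<open>z ^ k = 1\<close>, against primitivity.\<close>

lemma qint_nonzero: "0 < k \<Longrightarrow> k < m \<Longrightarrow> qint z k \<noteq> 0"
  using qint_geometric[of z k] prim by (auto simp: prim_root_unity_def)

lemma qfact_nonzero: "k < m \<Longrightarrow> qfact z k \<noteq> 0"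
  by (induction k) (auto simp: qfact_Suc qint_nonzero)

lemma qint_add_root: "qint z (k + m) = qint z k"
  by (simp add: qint_add)

lemma qint_mod_root: "qint z (k mod m) = qint z k"
proof (induction k rule: less_induct)
  case (less k)
  then show ?case
    using less[of "k - m"] qint_add_root[of "k - m"] m by (cases "k < m") (auto simp: le_mod_geq)
qed

lemma power_mod_root: "z ^ (k mod m) = z ^ k"
proof -
  have "z ^ k = z ^ (k mod m + m * (k div m))"
    by simp
  then show ?thesis
    by (simp only: power_add power_mult prim_root_power) simp
qed

text \<open>The boundary values set to 1 in \<open>qbinom\<close> agree with the quotient of
  factorials, whose denominator is nonzero below \<open>m\<close>.\<close>

lemma qbinom_mult:
  assumes "k + l < m"
  shows "qfact z k * qfact z l * qbinom z (k + l) k = qfact z (k + l)"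
  using qfact_nonzero[of k] qfact_nonzero[of l] assms by (auto simp: qbinom_def)

end


section \<open>Coordinates on the direct sum\<close>

locale LB_space = vector_space scale
  for scale :: "'f::field \<Rightarrow> 'l::ab_group_add \<Rightarrow> 'l" +
  fixes m :: nat and z :: 'f and B :: "'l set" and brB :: "'l \<Rightarrow> 'l \<Rightarrow> 'l"
    and V :: "nat \<Rightarrow> 'l set" and \<phi> :: "'l \<Rightarrow> 'l"
  assumes m: "2 \<le> m"
    and prim: "prim_root_unity m z"
    and simple: "simple_lie_algebra_on scale B brB"
    and V0: "V 0 = B"
    and decomp: "direct_sum_decomp scale m V"
    and linear_phi: "Vector_Spaces.linear scale scale \<phi>"
    and bij_phi: "\<forall>i\<in>{1..m - 1}. bij_betw \<phi> (V (i - 1)) (V i)"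
begin

lemmas linear_iff = linear_iff_maps[OF vector_space_axioms]

lemma linear_funpow:
  assumes "Vector_Spaces.linear scale scale f"
  shows "Vector_Spaces.linear scale scale (f ^^ n)"
  using assms by (induction n) (simp_all add: linear_iff)

lemmas linear_phi_pow = linear_funpow[OF linear_phi]

lemma phi_pow_add: "(\<phi> ^^ k) (x + y) = (\<phi> ^^ k) x + (\<phi> ^^ k) y"
  using linear_phi_pow by (simp add: linear_iff)

lemma phi_pow_scale: "(\<phi> ^^ k) (scale r x) = scale r ((\<phi> ^^ k) x)"
  using linear_phi_pow by (simp add: linear_iff)

lemma phi_pow_zero [simp]: "(\<phi> ^^ k) 0 = 0"
  by (rule linear_zero[OF linear_phi_pow])

lemma bij_phi_pow: "k < m \<Longrightarrow> bij_betw (\<phi> ^^ k) B (V k)"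
proof (induction k)
  case 0
  show ?case
    by (simp add: V0 bij_betw_def)
next
  case (Suc k)
  then have "bij_betw (\<phi> ^^ k) B (V k)" "bij_betw \<phi> (V k) (V (Suc k))"
    using bij_phi by (auto dest!: bspec[of _ _ "Suc k"])
  then show ?case
    unfolding funpow.simps by (rule bij_betw_trans)
qed

lemma V_eq: "k < m \<Longrightarrow> V k = (\<phi> ^^ k) ` B"
  using bij_phi_pow[of k] by (simp add: bij_betw_def)

section \<open>Bracket calculus in the simple Lie algebra \<open>B\<close>\<close>

lemma lie_B: "lie_algebra_on scale B brB"
  using simple by (simp add: simple_lie_algebra_on_def)

lemma subspace_B: "subspace B"
  using lie_B by (simp add: lie_algebra_on_def)

lemma B_closed [simp, intro]: "0 \<in> B" "a \<in> B \<Longrightarrow> b \<in> B \<Longrightarrow> a + b \<in> B" "a \<in> B \<Longrightarrow> scale r a \<in> B"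
  "a \<in> B \<Longrightarrow> b \<in> B \<Longrightarrow> brB a b \<in> B"
  using subspace_B lie_B by (auto simp: subspace_def lie_algebra_on_def)

lemma brB_simps:
  assumes "a \<in> B" "b \<in> B"
  shows "c \<in> B \<Longrightarrow> brB (a + b) c = brB a c + brB b c" "c \<in> B \<Longrightarrow> brB c (a + b) = brB c a + brB c b"
    and "brB (scale r a) b = scale r (brB a b)" "brB a (scale r b) = scale r (brB a b)"
    and "c \<in> B \<Longrightarrow> brB a (brB b c) + brB b (brB c a) + brB c (brB a b) = 0"
  using lie_B assms by (auto simp: lie_algebra_on_def)

lemma brB_self: "a \<in> B \<Longrightarrow> brB a a = 0"
  using lie_B by (simp add: lie_algebra_on_def)

lemma brB_swap:
  assumes "a \<in> B" "b \<in> B"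
  shows "brB b a = - brB a b"
proof -
  have "brB a (a + b) + brB b (a + b) = brB (a + b) (a + b)"
    using assms by (intro brB_simps(1)[symmetric]) auto
  also have "\<dots> = 0"
    using assms by (intro brB_self) auto
  finally show ?thesis
    using assms by (simp add: brB_simps brB_self eq_neg_iff_add_eq_0 add.commute)
qed

lemma brB_zero [simp]: "a \<in> B \<Longrightarrow> brB a 0 = 0" "a \<in> B \<Longrightarrow> brB 0 a = 0"
  using brB_simps(3,4)[of a a 0] brB_simps(3)[of 0 a 0] brB_simps(4)[of a 0 0] by simp_all

text \<open>Since \<open>\<phi> ^^ i\<close> maps \<open>B\<close> bijectively onto
  \<open>V i\<close>, the unique components in the direct sum become unique coordinates in
  \<open>B\<close>.\<close>

lemma ex1_coordinates: "\<exists>!f. f \<in> {..<m} \<rightarrow>\<^sub>E B \<and> x = (\<Sum>i<m. (\<phi> ^^ i) (f i))"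
proof (rule ex_ex1I)
  obtain g where g: "g \<in> (\<Pi>\<^sub>E i\<in>{..<m}. V i)" "x = (\<Sum>i<m. g i)"
    using decomp by (auto simp: direct_sum_decomp_def dest!: spec[of _ x])
  then have "\<exists>a\<in>B. g i = (\<phi> ^^ i) a" if "i < m" for i
    using V_eq[OF that] that by (force simp: PiE_iff)
  then obtain a where a: "\<And>i. i < m \<Longrightarrow> a i \<in> B \<and> g i = (\<phi> ^^ i) (a i)"
    by metis
  then have "restrict a {..<m} \<in> {..<m} \<rightarrow>\<^sub>E B \<and> x = (\<Sum>i<m. (\<phi> ^^ i) (restrict a {..<m} i))"
    using g by auto
  then show "\<exists>f. f \<in> {..<m} \<rightarrow>\<^sub>E B \<and> x = (\<Sum>i<m. (\<phi> ^^ i) (f i))"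
    by blast
next
  fix f f'
  assume f: "f \<in> {..<m} \<rightarrow>\<^sub>E B \<and> x = (\<Sum>i<m. (\<phi> ^^ i) (f i))"
    and f': "f' \<in> {..<m} \<rightarrow>\<^sub>E B \<and> x = (\<Sum>i<m. (\<phi> ^^ i) (f' i))"
  let ?g = "\<lambda>f. restrict (\<lambda>i. (\<phi> ^^ i) (f i)) {..<m}"
  have "?g h \<in> (\<Pi>\<^sub>E i\<in>{..<m}. V i) \<and> x = (\<Sum>i<m. ?g h i)"
    if "h \<in> {..<m} \<rightarrow>\<^sub>E B \<and> x = (\<Sum>i<m. (\<phi> ^^ i) (h i))" for h
    using that V_eq by (auto simp: PiE_iff)
  moreover have "\<exists>!h. h \<in> (\<Pi>\<^sub>E i\<in>{..<m}. V i) \<and> x = (\<Sum>i<m. h i)"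
    using decomp by (auto simp: direct_sum_decomp_def)
  ultimately have eq: "?g f = ?g f'"
    using f f' by blast
  have "f i = f' i" if "i < m" for i
  proof (rule inj_onD[OF bij_betw_imp_inj_on[OF bij_phi_pow[OF that]]])
    show "(\<phi> ^^ i) (f i) = (\<phi> ^^ i) (f' i)"
      using fun_cong[OF eq, of i] that by simp
  qed (use f f' that in auto)
  then show "f = f'"
    using f f' by (intro PiE_ext[of f "{..<m}" "\<lambda>_. B" f']) auto
qed

definition crd :: "'l \<Rightarrow> nat \<Rightarrow> 'l" where
  "crd x = (THE f. f \<in> {..<m} \<rightarrow>\<^sub>E B \<and> x = (\<Sum>i<m. (\<phi> ^^ i) (f i)))"

lemma crd_in_B: "i < m \<Longrightarrow> crd x i \<in> B"
  and sum_crd: "x = (\<Sum>i<m. (\<phi> ^^ i) (crd x i))"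
  using theI'[OF ex1_coordinates[of x]] by (auto simp: crd_def)

lemma crd_eqI:
  assumes "\<And>i. i < m \<Longrightarrow> f i \<in> B" and "x = (\<Sum>i<m. (\<phi> ^^ i) (f i))" and "i < m"
  shows "crd x i = f i"
proof -
  have "crd x = restrict f {..<m}"
    unfolding crd_def by (rule the1_equality[OF ex1_coordinates]) (use assms in auto)
  then show ?thesis
    using assms by simp
qed

lemma crd_add: "i < m \<Longrightarrow> crd (x + y) i = crd x i + crd y i"
  by (rule crd_eqI[where f = "\<lambda>i. crd x i + crd y i"])
    (simp_all add: crd_in_B phi_pow_add sum.distrib flip: sum_crd)

lemma crd_scale: "i < m \<Longrightarrow> crd (scale r x) i = scale r (crd x i)"
  by (rule crd_eqI[where f = "\<lambda>i. scale r (crd x i)"])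
    (simp_all add: crd_in_B phi_pow_scale flip: sum_crd scale_sum_right)

lemma crd_phi_pow:
  assumes "k < m" "a \<in> B" "i < m"
  shows "crd ((\<phi> ^^ k) a) i = (if i = k then a else 0)"
proof (rule crd_eqI[where f = "\<lambda>i. if i = k then a else 0"])
  have "(\<Sum>i<m. (\<phi> ^^ i) (if i = k then a else 0)) = (\<Sum>i<m. if i = k then (\<phi> ^^ i) a else 0)"
    by (rule sum.cong) auto
  then show "(\<phi> ^^ k) a = (\<Sum>i<m. (\<phi> ^^ i) (if i = k then a else 0))"
    using assms by simp
qed (use assms in auto)

section \<open>Linear maps prescribed on the elements \<open>(\<phi> ^^ k) a\<close>\<close>

lemma phi_pow_induct [case_names phi_pow add]:
  assumes "\<And>k a. k < m \<Longrightarrow> a \<in> B \<Longrightarrow> P ((\<phi> ^^ k) a)" and "\<And>x y. P x \<Longrightarrow> P y \<Longrightarrow> P (x + y)"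
  shows "P x"
proof -
  have "P 0"
    using assms(1)[of 0 0] m by simp
  have "P (\<Sum>i\<in>A. (\<phi> ^^ i) (crd x i))" if "finite A" "A \<subseteq> {..<m}" for A
    using that by induction (auto intro: assms \<open>P 0\<close> crd_in_B)
  from this[of "{..<m}"] show ?thesis
    by (simp flip: sum_crd)
qed

lemma linear_eqI:
  assumes "Vector_Spaces.linear scale scale f" "Vector_Spaces.linear scale scale g"
    and "\<And>k a. k < m \<Longrightarrow> a \<in> B \<Longrightarrow> f ((\<phi> ^^ k) a) = g ((\<phi> ^^ k) a)"
  shows "f x = g x"
  using assms(1,2) by (induction x rule: phi_pow_induct) (simp_all add: assms(3) linear_iff)

text \<open>When every \<open>h k\<close> is linear on \<open>B\<close>, this is the linear map that
  sends \<open>(\<phi> ^^ k) a\<close> to \<open>h k a\<close>.\<close>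

definition ext :: "(nat \<Rightarrow> 'l \<Rightarrow> 'l) \<Rightarrow> 'l \<Rightarrow> 'l" where
  "ext h x = (\<Sum>k<m. h k (crd x k))"

lemma linear_ext:
  assumes "\<And>k a b. k < m \<Longrightarrow> a \<in> B \<Longrightarrow> b \<in> B \<Longrightarrow> h k (a + b) = h k a + h k b"
    and "\<And>k a r. k < m \<Longrightarrow> a \<in> B \<Longrightarrow> h k (scale r a) = scale r (h k a)"
  shows "Vector_Spaces.linear scale scale (ext h)"
  by (simp add: linear_iff ext_def crd_add crd_scale crd_in_B assms scale_sum_right sum.distrib)

lemma ext_phi_pow:
  assumes "\<And>k. k < m \<Longrightarrow> h k 0 = 0" and "k < m" "a \<in> B"
  shows "ext h ((\<phi> ^^ k) a) = h k a"
proof -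
  have "ext h ((\<phi> ^^ k) a) = (\<Sum>i<m. if i = k then h i a else 0)"
    unfolding ext_def by (rule sum.cong) (use assms in \<open>auto simp: crd_phi_pow\<close>)
  then show ?thesis
    using assms by simp
qed


section \<open>Existence of the action and of the commutator\<close>

lemma LB_actionI:
  assumes "taft_module m z scale act"
    and "\<And>k a. k < m \<Longrightarrow> a \<in> B \<Longrightarrow> act (taft_c m z) ((\<phi> ^^ k) a) = scale (z ^ k) ((\<phi> ^^ k) a)"
    and "\<And>k a. Suc k < m \<Longrightarrow> a \<in> B \<Longrightarrow> act (taft_v m z) ((\<phi> ^^ Suc k) a) = (\<phi> ^^ k) a"
    and "\<And>a. a \<in> B \<Longrightarrow> act (taft_v m z) a = 0"
  shows "LB_action m z scale V \<phi> act"
  unfolding LB_action_def using assms by (auto simp: V_eq V0)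

text \<open>The operators of \<open>c\<close> and \<open>v\<close> are prescribed on
  \<open>(\<phi> ^^ k) a\<close>. Linearity reduces the Taft relations to these elements, and
  \<open>ex_taft_module\<close> then supplies the action.\<close>

lemma ex_LB_action: "\<exists>act. LB_action m z scale V \<phi> act"
proof -
  define C where "C = ext (\<lambda>k a. scale (z ^ k) ((\<phi> ^^ k) a))"
  \<comment> \<open>The case \<open>k = 0\<close> is separate because truncated subtraction would
    make \<open>D\<close> the identity on \<open>B\<close> instead of zero.\<close>
  define D where "D = ext (\<lambda>k a. if k = 0 then 0 else (\<phi> ^^ (k - 1)) a)"
  have C: "Vector_Spaces.linear scale scale C"
    unfolding C_def by (rule linear_ext) (simp_all add: phi_pow_add phi_pow_scale scale_right_distrib mult.commute)
  have D: "Vector_Spaces.linear scale scale D"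
    unfolding D_def by (rule linear_ext) (simp_all add: phi_pow_add phi_pow_scale)
  have C_phi: "C ((\<phi> ^^ k) a) = scale (z ^ k) ((\<phi> ^^ k) a)" if "k < m" "a \<in> B" for k a
    unfolding C_def using that by (simp add: ext_phi_pow)
  have D_phi: "D ((\<phi> ^^ k) a) = (if k = 0 then 0 else (\<phi> ^^ (k - 1)) a)" if "k < m" "a \<in> B" for k a
    unfolding D_def using that by (subst ext_phi_pow) auto
  have scale_C: "C (scale r x) = scale r (C x)" and scale_D: "D (scale r x) = scale r (D x)" for r x
    using C D by (auto simp: linear_iff)
  have D0: "D 0 = 0"
    by (rule linear_zero[OF D])
  have "(C ^^ m) x = x" for x
  proof (rule linear_eqI[of "C ^^ m" "\<lambda>x. x"])
    fix k a assume "k < m" "a \<in> B"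
    \<comment> \<open>Each application contributes the factor \<open>z ^ k\<close>; after
      \<open>m\<close> of them the factor is \<open>(z ^ m) ^ k = 1\<close>.\<close>
    then have "(C ^^ n) ((\<phi> ^^ k) a) = scale ((z ^ n) ^ k) ((\<phi> ^^ k) a)" for n
      by (induction n) (simp_all add: scale_C C_phi power_mult_distrib mult.commute)
    then show "(C ^^ m) ((\<phi> ^^ k) a) = (\<phi> ^^ k) a"
      by (simp add: prim_root_power[OF prim m])
  qed (use C linear_funpow linear_ident in auto)
  moreover have "(D ^^ m) x = 0" for x
  proof (rule linear_eqI[of "D ^^ m" "\<lambda>x. 0"])
    fix k a assume "k < m" "a \<in> B"
    have "(D ^^ n) 0 = 0" for n
      by (rule linear_zero[OF linear_funpow[OF D]])
    \<comment> \<open>Every application lowers the index by one until an element of \<open>B\<close>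
      is reached, which the next application kills.\<close>
    then have "k < n \<Longrightarrow> (D ^^ n) ((\<phi> ^^ k) a) = 0" for n
      using \<open>k < m\<close> \<open>a \<in> B\<close>
      by (induction n arbitrary: k) (auto simp: D_phi funpow_Suc_right simp del: funpow.simps)
    then show "(D ^^ m) ((\<phi> ^^ k) a) = 0"
      using \<open>k < m\<close> by simp
  qed (use D linear_funpow in \<open>auto simp: linear_iff\<close>)
  moreover have "D (C x) = scale z (C (D x))" for x
  proof (rule linear_eqI[of "\<lambda>x. D (C x)" "\<lambda>x. scale z (C (D x))"])
    fix k a assume "k < m" "a \<in> B"
    then show "D (C ((\<phi> ^^ k) a)) = scale z (C (D ((\<phi> ^^ k) a)))"
      using linear_zero[OF C] C_phi[of 0] D_phi[of 0]
      by (cases k) (simp_all add: C_phi D_phi scale_D del: funpow.simps(2))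
  qed (use C D in \<open>auto simp: linear_iff scale_right_distrib mult.commute\<close>)
  ultimately obtain act where act: "taft_module m z scale act" "act (taft_c m z) = C" "act (taft_v m z) = D"
    using ex_taft_module[OF vector_space_axioms C D] by blast
  have "LB_action m z scale V \<phi> act"
    using D_phi[of 0] D_phi[of "Suc _"] m by (intro LB_actionI) (auto simp: act C_phi simp del: funpow.simps(2))
  then show ?thesis
    by blast
qed

text \<open>The prescribed values are bilinear in \<open>a\<close> and \<open>b\<close>, so two
  nested linear extensions, one for each argument, give the commutator.\<close>

lemma ex_LB_bracket: "\<exists>br. LB_bracket m z \<gamma> scale V brB \<phi> br"
proof -
  define s where "s k l = (if k + l < m then qbinom z (k + l) k
    else \<gamma> * (qfact z (k + l - m) / (qfact z k * qfact z l)))" for k l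
  define K where "K k l a b = scale (s k l) ((\<phi> ^^ (if k + l < m then k + l else k + l - m)) (brB a b))"
    for k l a b
  define br where "br x y = ext (\<lambda>k a. ext (\<lambda>l b. K k l a b) y) x" for x y
  have K_simps: "K k l (a + b) c = K k l a c + K k l b c" "K k l c (a + b) = K k l c a + K k l c b"
    "K k l (scale r a) b = scale r (K k l a b)" "K k l a (scale r b) = scale r (K k l a b)"
    if "a \<in> B" "b \<in> B" "c \<in> B" for k l a b c r
    using that by (auto simp: K_def brB_simps phi_pow_add phi_pow_scale scale_right_distrib mult.commute)
  have K_zero: "K k l a 0 = 0" "K k l 0 a = 0" if "a \<in> B" for k l a
    using that by (auto simp: K_def)
  have inner: "Vector_Spaces.linear scale scale (ext (\<lambda>l b. K k l a b))" if "a \<in> B" for k a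
    by (rule linear_ext) (use that in \<open>auto simp: K_simps\<close>)
  have "LB_bracket m z \<gamma> scale V brB \<phi> br"
    unfolding LB_bracket_def
  proof (intro conjI allI impI ballI)
    show "Vector_Spaces.linear scale scale (br x)" for x
      using inner[OF crd_in_B]
      by (simp add: br_def[abs_def] ext_def[of _ x] linear_iff sum.distrib scale_sum_right)
    show "Vector_Spaces.linear scale scale (\<lambda>x. br x y)" for y
      unfolding br_def
    proof (rule linear_ext)
      show "ext (\<lambda>l b. K k l (a + b') b) y = ext (\<lambda>l b. K k l a b) y + ext (\<lambda>l b. K k l b' b) y"
        if "a \<in> B" "b' \<in> B" for k a b'
        using that by (simp add: ext_def K_simps crd_in_B sum.distrib)
      show "ext (\<lambda>l b. K k l (scale r a) b) y = scale r (ext (\<lambda>l b. K k l a b) y)" if "a \<in> B" for k a r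
        using that by (simp add: ext_def K_simps crd_in_B scale_sum_right)
    qed
    show "br ((\<phi> ^^ k) a) ((\<phi> ^^ l) b) =
          (if k + l < m
           then scale (qbinom z (k + l) k) ((\<phi> ^^ (k + l)) (brB a b))
           else scale (\<gamma> * (qfact z (k + l - m) / (qfact z k * qfact z l)))
                  ((\<phi> ^^ (k + l - m)) (brB a b)))"
      if "k < m" "l < m" "a \<in> V 0" "b \<in> V 0" for k l a b
    proof -
      have "br ((\<phi> ^^ k) a) ((\<phi> ^^ l) b) = ext (\<lambda>l b. K k l a b) ((\<phi> ^^ l) b)"
        unfolding br_def using that
        by (intro ext_phi_pow) (auto simp: V0 ext_def crd_in_B K_zero intro!: sum.neutral)
      also have "\<dots> = K k l a b"
        using that by (intro ext_phi_pow) (auto simp: V0 K_zero)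
      finally show ?thesis
        by (simp add: K_def s_def)
    qed
  qed
  then show ?thesis
    by blast
qed

end


section \<open>The twisted current algebra\<close>

text \<open>Below, \<open>E n a\<close> plays the role of \<open>t\<^sup>n \<otimes> a\<close> modulo \<open>t\<^sup>m = \<gamma>\<close>; allowing all \<open>n\<close> removes the case
  distinction \<open>k + l < m\<close> from the commutator.\<close>

locale LB_algebra = LB_space scale m z B brB V \<phi>
  for scale :: "'f::field \<Rightarrow> 'l::ab_group_add \<Rightarrow> 'l" and m z B brB V \<phi> +
  fixes \<gamma> :: 'f and act :: "'f free_alg set \<Rightarrow> 'l \<Rightarrow> 'l" and br :: "'l \<Rightarrow> 'l \<Rightarrow> 'l"
  assumes action: "LB_action m z scale V \<phi> act" and bracket: "LB_bracket m z \<gamma> scale V brB \<phi> br"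
begin

abbreviation "C \<equiv> act (taft_c m z)"
abbreviation "D \<equiv> act (taft_v m z)"

text \<open>For \<open>n < m\<close> the power of \<gamma> is 1, even if \<gamma> is zero, so
  \<open>E n a\<close> is an invertible multiple of \<open>(\<phi> ^^ n) a\<close>. For
  \<open>n \<ge> m\<close> and \<gamma> zero it vanishes.\<close>

definition E :: "nat \<Rightarrow> 'l \<Rightarrow> 'l" where
  "E n a = scale (\<gamma> ^ (n div m) * qfact z (n mod m)) ((\<phi> ^^ (n mod m)) a)"

lemma E_add: "E n (a + b) = E n a + E n b"
  by (simp add: E_def phi_pow_add scale_right_distrib)

lemma E_scale: "E n (scale r a) = scale r (E n a)"
  by (simp add: E_def phi_pow_scale mult.commute)

lemma linear_E: "Vector_Spaces.linear scale scale (E n)"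
  by (simp add: linear_iff E_add E_scale)

lemma E_zero [simp]: "E n 0 = 0"
  by (rule linear_zero[OF linear_E])

lemma E_uminus: "E n (- a) = - E n a"
  using E_add[of n a "- a"] by (simp add: eq_neg_iff_add_eq_0 add.commute)

lemma E_0 [simp]: "E 0 a = a"
  by (simp add: E_def)

lemma E_add_mult: "E (n + q * m) a = scale (\<gamma> ^ q) (E n a)"
  using m by (simp add: E_def power_add)

lemma E_div_mod: "E n a = scale (\<gamma> ^ (n div m)) (E (n mod m) a)"
  using E_add_mult[of "n mod m" "n div m" a] by simp

lemma phi_pow_conv_E: "k < m \<Longrightarrow> (\<phi> ^^ k) a = E k (scale (inverse (qfact z k)) a)"
  using qfact_nonzero[OF prim m] by (simp add: E_def phi_pow_scale)

text \<open>The rescaling is invertible below \<open>m\<close>, so identities that are additive in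
  each argument need checking only on the elements \<open>E k a\<close>.\<close>

lemma E_induct [case_names E add]:
  assumes "\<And>k a. a \<in> B \<Longrightarrow> P (E k a)" and "\<And>x y. P x \<Longrightarrow> P y \<Longrightarrow> P (x + y)"
  shows "P x"
  by (induction x rule: phi_pow_induct) (auto simp: phi_pow_conv_E intro!: assms)

lemma bilin_br: "bilin scale br"
  using bracket by (simp add: LB_bracket_def bilin_def)

lemma br_simps:
  "br (x + y) w = br x w + br y w" "br w (x + y) = br w x + br w y"
  "br (scale r x) y = scale r (br x y)" "br x (scale r y) = scale r (br x y)"
  using bilin_br by (auto simp: bilin_def linear_iff)

text \<open>The factor \<open>qfact z k * qfact z l\<close> cancels the denominators in both cases
  of the commutator and leaves the factorial that belongs to \<open>E (k + l)\<close>.\<close>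

lemma br_E_less:
  assumes "k < m" "l < m" "a \<in> B" "b \<in> B"
  shows "br (E k a) (E l b) = E (k + l) (brB a b)"
proof -
  have *: "br (E k a) (E l b) = scale (qfact z k * qfact z l) (br ((\<phi> ^^ k) a) ((\<phi> ^^ l) b))"
    using assms by (simp add: E_def br_simps)
  show ?thesis
  proof (cases "k + l < m")
    case True
    then have "br ((\<phi> ^^ k) a) ((\<phi> ^^ l) b) = scale (qbinom z (k + l) k) ((\<phi> ^^ (k + l)) (brB a b))"
      using bracket assms by (simp add: LB_bracket_def V0)
    then show ?thesis
      using True unfolding * by (simp add: E_def qbinom_mult[OF prim m])
  next
    case False
    then have "br ((\<phi> ^^ k) a) ((\<phi> ^^ l) b) = scale (\<gamma> * (qfact z (k + l - m) / (qfact z k * qfact z l)))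
        ((\<phi> ^^ (k + l - m)) (brB a b))"
      using bracket assms by (simp add: LB_bracket_def V0)
    \<comment> \<open>As \<open>k + l < 2 * m\<close>, the index wraps around exactly once, which
      accounts for the single factor \<gamma>.\<close>
    moreover have "(k + l) div m = 1" "(k + l) mod m = k + l - m"
      using False assms by (auto simp: div_if le_mod_geq)
    ultimately show ?thesis
      unfolding * using assms qfact_nonzero[OF prim m] by (simp add: E_def)
  qed
qed

text \<open>Both indices are reduced modulo \<open>m\<close>, where \<open>br_E_less\<close>
  applies; the powers of \<gamma> split off are then turned back into multiples of \<open>m\<close>
  in the index.\<close>

lemma br_E:
  assumes "a \<in> B" "b \<in> B"
  shows "br (E k a) (E l b) = E (k + l) (brB a b)"
proof -
  have "br (E k a) (E l b) = scale (\<gamma> ^ (k div m + l div m)) (E (k mod m + l mod m) (brB a b))"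
    unfolding E_div_mod[of k] E_div_mod[of l]
    using m assms by (simp add: br_simps br_E_less power_add)
  also have "\<dots> = E (k mod m + l mod m + (k div m + l div m) * m) (brB a b)"
    by (simp only: E_add_mult)
  also have "k mod m + l mod m + (k div m + l div m) * m = k + l"
    using div_mult_mod_eq[of k m] div_mult_mod_eq[of l m] by (simp add: algebra_simps)
  finally show ?thesis .
qed

section \<open>The operators of \<open>c\<close> and \<open>v\<close> on the elements
  \<open>E n a\<close>\<close>

lemma module_act: "taft_module m z scale act"
  using action by (simp add: LB_action_def)

lemma linear_C: "Vector_Spaces.linear scale scale C" and linear_D: "Vector_Spaces.linear scale scale D"
  using module_act taft_class_in_carrier by (auto simp: taft_module_def taft_c_def taft_v_def)

lemma C_E:
  assumes "a \<in> B"
  shows "C (E n a) = scale (z ^ n) (E n a)"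
proof -
  have "C ((\<phi> ^^ (n mod m)) a) = scale (z ^ (n mod m)) ((\<phi> ^^ (n mod m)) a)"
    using action assms m by (simp add: LB_action_def V_eq)
  then show ?thesis
    using linear_C by (simp add: E_def linear_iff power_mod_root[OF prim m] mult.commute)
qed

lemma D_phi_pow: "Suc k < m \<Longrightarrow> a \<in> B \<Longrightarrow> D ((\<phi> ^^ Suc k) a) = (\<phi> ^^ k) a"
  using action by (simp add: LB_action_def V_eq)

lemma D_B: "a \<in> B \<Longrightarrow> D a = 0"
  using action by (simp add: LB_action_def V0)

text \<open>If \<open>m\<close> divides \<open>n\<close>, then \<open>E n a\<close> lies in
  \<open>B\<close> and the coefficient \<open>qint z n\<close> is zero; this covers
  \<open>n = 0\<close>, where \<open>n - 1\<close> is truncated. Otherwise one factor of the quantum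
  factorial is released.\<close>

lemma D_E:
  assumes "a \<in> B"
  shows "D (E n a) = scale (qint z n) (E (n - 1) a)"
proof (cases "n mod m")
  case 0
  then have "qint z n = 0"
    using qint_mod_root[OF prim m, of n] by simp
  then show ?thesis
    using 0 assms linear_D by (simp add: E_def linear_iff D_B)
next
  case (Suc k)
  then obtain n' where n': "n = Suc n'"
    by (cases n) auto
  have n'_mod: "n' mod m = k"
    using Suc n' by (auto simp: mod_Suc split: if_splits)
  \<comment> \<open>Passing to the predecessor of a non-multiple of \<open>m\<close> leaves the
    power of \<gamma> unchanged.\<close>
  have n'_div: "n' div m = n div m"
    using Suc n' by (auto simp: div_Suc)
  have less: "Suc k < m"
    using m by (simp flip: Suc)
  have "D (E n a) = scale (\<gamma> ^ (n div m) * qfact z (Suc k)) ((\<phi> ^^ k) a)"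
    using linear_D D_phi_pow[OF less assms] by (simp add: E_def linear_iff Suc del: funpow.simps)
  also have "\<dots> = scale (qint z n) (E n' a)"
    using Suc qint_mod_root[OF prim m, of n]
    by (simp add: E_def n'_mod n'_div qfact_Suc ac_simps)
  finally show ?thesis
    by (simp add: n')
qed

section \<open>Compatibility of the commutator with the two generators\<close>

lemma C_br: "C (br x y) = br (C x) (C y)"
proof (induction x rule: E_induct)
  case (E k a)
  note a = E
  show ?case
  proof (induction y rule: E_induct)
    case (E l b)
    with a show ?case
      by (simp add: br_E C_E br_simps power_add)
  qed (use linear_C in \<open>simp add: linear_iff br_simps\<close>)
qed (use linear_C in \<open>simp add: linear_iff br_simps\<close>)

text \<open>On \<open>E k a\<close> and \<open>E l b\<close> the rule amounts to
  \<open>qint z (k + l) = qint z k + z ^ k * qint z l\<close>.\<close>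

lemma D_br: "D (br x y) = br (C x) (D y) + br (D x) y"
proof (induction x rule: E_induct)
  case (E k a)
  note a = E
  show ?case
  proof (induction y rule: E_induct)
    case (E l b)
    have "D (br (E k a) (E l b)) = scale (qint z (k + l)) (E (k + l - 1) (brB a b))"
      using a E by (simp add: br_E D_E)
    \<comment> \<open>For \<open>l = 0\<close> the indices \<open>k + (l - 1)\<close> and
      \<open>k + l - 1\<close> can differ by truncation, but then both sides are zero.\<close>
    moreover have "br (C (E k a)) (D (E l b)) = scale (z ^ k * qint z l) (E (k + l - 1) (brB a b))"
      using a E by (cases l) (simp_all add: br_E C_E D_E D_B br_simps bilin_zero_right[OF bilin_br])
    moreover have "br (D (E k a)) (E l b) = scale (qint z k) (E (k + l - 1) (brB a b))"
      using a E by (cases k) (simp_all add: br_E D_E D_B br_simps bilin_zero_left[OF bilin_br])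
    ultimately show ?case
      by (simp add: qint_add scale_left_distrib add.commute)
  qed (use linear_D in \<open>simp add: linear_iff br_simps\<close>)
qed (use linear_C linear_D in \<open>simp add: linear_iff br_simps\<close>)

section \<open>The Lie algebra axioms\<close>

lemma br_swap: "br y x = - br x y"
proof (induction x rule: E_induct)
  case (E k a)
  note a = E
  show ?case
  proof (induction y rule: E_induct)
    case (E l b)
    then show ?case
      using a brB_swap[OF a E] by (simp add: br_E E_uminus add.commute)
  qed (simp add: br_simps)
qed (simp add: br_simps)

text \<open>The condition is quadratic in \<open>x\<close>: for a sum of two elements the cross
  terms cancel by \<open>br_swap\<close>.\<close>

lemma br_self: "br x x = 0"
proof (induction x rule: E_induct)
  case (add x y)
  then show ?case
    using br_swap[of x y] by (simp add: br_simps)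
qed (simp add: br_E brB_self)

text \<open>On elements \<open>E j a\<close>, \<open>E k b\<close>, \<open>E l c\<close> all three
  terms have index \<open>j + k + l\<close>, which leaves the Jacobi identity of
  \<open>B\<close>.\<close>

lemma br_jacobi: "br x (br y w) + br y (br w x) + br w (br x y) = 0"
proof (induction x rule: E_induct)
  case (E j a)
  note a = E
  show ?case
  proof (induction y rule: E_induct)
    case (E k b)
    note b = E
    show ?case
    proof (induction w rule: E_induct)
      case (E l c)
      have "br (E j a) (br (E k b) (E l c)) + br (E k b) (br (E l c) (E j a)) +
          br (E l c) (br (E j a) (E k b)) =
        E (j + k + l) (brB a (brB b c) + brB b (brB c a) + brB c (brB a b))"
        using a b E by (simp add: br_E E_add ac_simps)
      then show ?case
        using a b E by (simp add: brB_simps)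
    next
      case (add x y)
      \<comment> \<open>The two induction hypotheses are added as equations.\<close>
      from arg_cong2[OF add, of "(+)"] show ?case
        by (simp add: br_simps ac_simps)
    qed
  next
    case (add x y)
    from arg_cong2[OF add, of "(+)"] show ?case
      by (simp add: br_simps ac_simps)
  qed
next
  case (add x y)
  from arg_cong2[OF add, of "(+)"] show ?case
    by (simp add: br_simps ac_simps)
qed

lemma lie_algebra: "lie_algebra_on scale UNIV br"
  unfolding lie_algebra_on_def
  by (auto simp: br_simps br_self br_jacobi vector_space_axioms)

lemma module_lie_algebra: "taft_module_lie_algebra m z scale act br"
  unfolding taft_module_lie_algebra_def
  using module_act lie_algebra taft_module_sweedler[OF module_act bilin_br C_br D_br] by blast


section \<open>Simplicity\<close>

lemma D_pow: "(D ^^ m) x = 0"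
proof (induction x rule: phi_pow_induct)
  case (phi_pow k a)
  have zero: "(D ^^ n) 0 = 0" for n
    by (rule linear_zero[OF linear_funpow[OF linear_D]])
  have "k < n \<Longrightarrow> k < m \<Longrightarrow> (D ^^ n) ((\<phi> ^^ k) a) = 0" for n
  proof (induction n arbitrary: k)
    case (Suc n)
    then show ?case
      using \<open>a \<in> B\<close> by (cases k) (simp_all add: funpow_Suc_right[of n D] D_B D_phi_pow zero del: funpow.simps(2))
  qed simp
  then show ?case
    using phi_pow by simp
qed (use linear_funpow[OF linear_D] in \<open>simp add: linear_iff\<close>)

text \<open>The coordinates of \<open>D x\<close> are those of \<open>x\<close> shifted down by one,
  so \<open>D x = 0\<close> leaves only the coordinate of index 0.\<close>

lemma D_kernel:
  assumes "D x = 0"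
  shows "x \<in> B"
proof -
  obtain n where n: "m = Suc n"
    using m by (cases m) auto
  have shift: "(\<Sum>i<m. h i) = h 0 + (\<Sum>i<n. h (Suc i))" and last: "(\<Sum>i<m. h i) = (\<Sum>i<n. h i) + h n"
    for h :: "nat \<Rightarrow> 'l"
    unfolding n by (rule sum.lessThan_Suc_shift, simp)
  have less: "Suc i < m \<longleftrightarrow> i < n" for i
    by (simp add: n)
  have crd_0: "crd x 0 \<in> B"
    using m by (simp add: crd_in_B)
  \<comment> \<open>The shifted coordinates are padded by 0 at the top index
    \<open>n = m - 1\<close>.\<close>
  let ?f = "\<lambda>i. if i < n then crd x (Suc i) else 0"
  have "D x = D (\<Sum>i<m. (\<phi> ^^ i) (crd x i))"
    by (simp flip: sum_crd)
  also have "\<dots> = (\<Sum>i<m. D ((\<phi> ^^ i) (crd x i)))"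
    using linear_D by (simp add: linear_iff_module_hom module_hom.sum)
  also have "\<dots> = (\<Sum>i<n. (\<phi> ^^ i) (crd x (Suc i)))"
    unfolding shift by (simp add: D_B crd_0 D_phi_pow less crd_in_B del: funpow.simps(2))
  also have "\<dots> = (\<Sum>i<m. (\<phi> ^^ i) (?f i))"
    by (simp add: last)
  finally have "crd (D x) i = ?f i" if "i < m" for i
    using that by (intro crd_eqI) (simp_all add: less crd_in_B)
  moreover have "crd (D x) i = 0" if "i < m" for i
    using crd_scale[OF that, of 0 0] assms by simp
  ultimately have "?f i = 0" if "i < m" for i
    using that by metis
  then have "crd x (Suc i) = 0" if "i < n" for i
    using that n by (metis less_SucI)
  then have "(\<Sum>i<m. (\<phi> ^^ i) (crd x i)) = crd x 0"
    unfolding shift by (simp del: funpow.simps(2))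
  then have "crd x 0 = x"
    by (simp flip: sum_crd)
  then show ?thesis
    using crd_0 by simp
qed

text \<open>The span of the brackets is a nonzero ideal of \<open>B\<close>, hence all of
  \<open>B\<close> by simplicity.\<close>

lemma B_derived: "span {brB a b | a b. a \<in> B \<and> b \<in> B} = B"
proof -
  let ?S = "{brB a b | a b. a \<in> B \<and> b \<in> B}"
  have "span ?S \<subseteq> B"
    using subspace_B by (intro span_minimal) auto
  then have "lie_ideal_on scale B brB (span ?S)"
    by (auto simp: lie_ideal_on_def intro!: span_base)
  then show ?thesis
    using simple by (auto simp: simple_lie_algebra_on_def lie_derived_def)
qed

text \<open>As \<open>E 0\<close> is the identity, \<open>br\<close> restricts to \<open>brB\<close>
  on \<open>B\<close>, whose derived algebra is nonzero.\<close>

lemma derived_nonzero: "lie_derived scale UNIV br \<noteq> {0}"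
proof
  assume zero: "lie_derived scale UNIV br = {0}"
  have "brB a b = 0" if "a \<in> B" "b \<in> B" for a b
  proof -
    have "br a b \<in> lie_derived scale UNIV br"
      by (auto simp: lie_derived_def intro!: span_base)
    then show ?thesis
      using zero br_E[OF that, of 0 0] by simp
  qed
  then have "lie_derived scale B brB \<subseteq> {0}"
    unfolding lie_derived_def by (intro span_minimal) auto
  then show False
    using simple span_zero by (auto simp: simple_lie_algebra_on_def lie_derived_def)
qed

lemma invariant_ideal_trivial:
  assumes J: "lie_ideal_on scale UNIV br J" and inv: "\<And>x. x \<in> J \<Longrightarrow> D x \<in> J" and "J \<noteq> {0}"
  shows "J = UNIV"
proof -
  have sub: "subspace J" and br_J: "\<And>x y. y \<in> J \<Longrightarrow> br x y \<in> J"
    using J by (auto simp: lie_ideal_on_def)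
  obtain x where x: "x \<in> J" "x \<noteq> 0"
    using \<open>J \<noteq> {0}\<close> subspace_0[OF sub] by auto
  \<comment> \<open>For the least annihilating exponent, the previous power of \<open>D\<close>
    yields a nonzero element of the kernel of \<open>D\<close>.\<close>
  define n where "n = (LEAST n. (D ^^ n) x = 0)"
  have n: "(D ^^ n) x = 0"
    unfolding n_def by (rule LeastI[of _ m]) (rule D_pow)
  then obtain n' where n': "n = Suc n'"
    using x by (cases n) auto
  then have "(D ^^ n') x \<noteq> 0"
    using not_less_Least[of n' "\<lambda>n. (D ^^ n) x = 0"] by (simp add: n_def)
  moreover have "(D ^^ n') x \<in> B"
    using n n' by (intro D_kernel) simp
  moreover have "(D ^^ n') x \<in> J"
    by (induction n') (use x inv in auto)
  ultimately have "J \<inter> B \<noteq> {0}"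
    by auto
  \<comment> \<open>Since \<open>br\<close> and \<open>brB\<close> agree on \<open>B\<close>,
    simplicity of \<open>B\<close> applies to the intersection.\<close>
  moreover have "lie_ideal_on scale B brB (J \<inter> B)"
    unfolding lie_ideal_on_def
  proof (intro conjI ballI)
    show "subspace (J \<inter> B)"
      using sub subspace_B by (rule subspace_inter)
    show "brB a b \<in> J \<inter> B" if "a \<in> B" "b \<in> J \<inter> B" for a b
      using that br_J[of b a] br_E[of a b 0 0] by auto
  qed auto
  ultimately have "B \<subseteq> J"
    using simple by (auto simp: simple_lie_algebra_on_def)
  have E_J: "E k a \<in> J" if "a \<in> B" for k a
  proof -
    \<comment> \<open>Every \<open>E k (brB a b)\<close> equals \<open>br (E k a) b\<close> with
      \<open>b\<close> in \<open>J\<close>. As \<open>E k\<close> is linear and brackets span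
      \<open>B\<close>, this suffices.\<close>
    have "span {brB a b | a b. a \<in> B \<and> b \<in> B} \<subseteq> E k -` J"
    proof (rule span_minimal)
      show "subspace (E k -` J)"
        using sub by (simp add: subspace_def E_add E_scale)
      show "{brB a b | a b. a \<in> B \<and> b \<in> B} \<subseteq> E k -` J"
      proof clarify
        fix a b assume "a \<in> B" "b \<in> B"
        then show "brB a b \<in> E k -` J"
          using br_J[of b "E k a"] br_E[of a b k 0] \<open>B \<subseteq> J\<close> by auto
      qed
    qed
    then show ?thesis
      using that by (auto simp: B_derived)
  qed
  have "x \<in> J" for x
    by (induction x rule: E_induct) (use E_J sub in \<open>auto simp: subspace_def\<close>)
  then show ?thesis
    by blast
qed

lemma simple_algebra: "taft_simple m z scale act br"
  unfolding taft_simple_def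
  using derived_nonzero invariant_ideal_trivial taft_class_in_carrier[of m z free_v]
  by (auto simp: taft_v_def)

end

text \<open>The first conjunct gives existence of the prescribed action and commutator, so the
  second, about every such pair, is not vacuous.\<close>

theorem theorem4p1:
  fixes scale :: "'f::field \<Rightarrow> 'l::ab_group_add \<Rightarrow> 'l"
    and m :: nat and \<zeta> \<gamma> :: 'f
    and B :: "'l set" and brB :: "'l \<Rightarrow> 'l \<Rightarrow> 'l"
    and V :: "nat \<Rightarrow> 'l set" and \<phi> :: "'l \<Rightarrow> 'l"
  assumes "m \<ge> 2"
    and "prim_root_unity m \<zeta>"
    and "vector_space scale"
    and "simple_lie_algebra_on scale B brB"
    and "V 0 = B"
    and "direct_sum_decomp scale m V"
    and "Vector_Spaces.linear scale scale \<phi>"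
    and "\<forall>i\<in>{1..m - 1}. bij_betw \<phi> (V (i - 1)) (V i)"
    and "\<phi> ` V (m - 1) = {0}"
  shows "(\<exists>act br. LB_action m \<zeta> scale V \<phi> act \<and> LB_bracket m \<zeta> \<gamma> scale V brB \<phi> br) \<and>
         (\<forall>act br. LB_action m \<zeta> scale V \<phi> act \<and> LB_bracket m \<zeta> \<gamma> scale V brB \<phi> br \<longrightarrow>
           taft_module_lie_algebra m \<zeta> scale act br \<and> taft_simple m \<zeta> scale act br)"
proof -
  interpret LB_space scale m \<zeta> B brB V \<phi>
    using assms by (simp add: LB_space_def LB_space_axioms_def)
  have "taft_module_lie_algebra m \<zeta> scale act br \<and> taft_simple m \<zeta> scale act br"
    if "LB_action m \<zeta> scale V \<phi> act" "LB_bracket m \<zeta> \<gamma> scale V brB \<phi> br" for act br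
  proof -
    interpret LB_algebra scale m \<zeta> B brB V \<phi> \<gamma> act br
      using that by unfold_locales
    show ?thesis
      using module_lie_algebra simple_algebra by blast
  qed
  then show ?thesis
    using ex_LB_action ex_LB_bracket by blast
qed

end
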